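(* Let $\mathcal D=\{\xi_1,\dots,\xi_N\}$, $f(\cdot;\xi)$, $F$, $F^\star$ and the DiSK iteration (with SGD base update) be as described in the context, and suppose Assumptions (A1)–(A3) hold. Fix $\sigma_{\mathrm{DP}}^2\ge 0$, $\gamma\in\mathbb R\setminus\{0\}$, and choose the clipping threshold $C\ge \left(1+\frac{2(1-\kappa)}{\kappa}\right)G$. Define $$M_\gamma = 1+\frac{4\left(2+1/\kappa+|1+\gamma|\right)}{\gamma^2},\qquad Q=1+4\eta^2L^2+|1+\gamma|\left(\kappa+2\eta^2L^2M_\gamma\right),$$ let $\beta\ge 0$ satisfy $$\beta \ge \frac{\eta(1-\kappa)/2+\eta^2L(1-\kappa)^2 Q}{1-(1-\kappa)^2 Q}\ \ (\ge 0),$$ and set $$M_1=(1+\kappa-2\eta L)-4(\beta+\eta^2L)(1-\kappa)^2L^2\eta\left(2+|1+\gamma|M_\gamma\right).$$ Suppose $\kappa\in(0,1]$ and $\eta>0$ satisfy $$\eta<\frac{1+\kappa}{2L\left(1+2(1-\kappa)^2\beta L\left(2+|1+\gamma|M_\gamma\right)\right)},\qquad \kappa>1-\frac{1}{\sqrt{Q}},$$ and that $M_1>0$. Run the iteration for $T$ iterations. Then $$\frac{1}{T}\sum_{t=0}^{T}\mathbb E\|\nabla F(x_t)\|^2\le \frac{2\left(F(x_0)+\beta\|\nabla F(x_0)\|^2-F^\star\right)}{M_1\eta T}+\frac{2(\beta+\eta^2L)\kappa^2}{M_1\eta}\left(\frac{(2+|1+\gamma|)\sigma_{\mathrm{SG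D}}^2}{B}+d\,\sigma_{\mathrm{DP}}^2\right).$$
   Context: Let $\mathcal D=\{\xi_1,\dots,\xi_N\}$ be a finite dataset, $f(\cdot;\xi):\mathbb R^d\to\mathbb R$ differentiable loss functions, $F(x)=\frac1N\sum_{\xi\in\mathcal D}f(x;\xi)$, and $F^\star=\inf_x F(x)$ (assumed finite). For $v\in\mathbb R^d$, $\mathrm{clip}(v,C)=\min\{1,C/\|v\|\}\,v$. DiSK iteration with SGD base update, parameters $x_0\in\mathbb R^d$, step size $\eta>0$, $\gamma\neq 0$, $\kappa\in(0,1]$, clipping threshold $C>0$, noise level $\sigma_{\mathrm{DP}}\ge 0$, batch size $B\ge1$: initialize $\tilde g_{-1}=0$, $d_{-1}=0$; for $t=0,1,\dots$: draw a minibatch $\mathcal B_t$ of $B$ samples uniformly at random from $\mathcal D$ (independently of the past), set $a=\frac{1-\kappa}{\kappa\gamma}$ and $g_t=\frac1B\sum_{\xi\in\mathcal B_t}\mathrm{clip}\big(a\nabla f(x_t+\gamma d_{t-1};\xi)+(1-a)\nabla f(x_t;\xi),C\big)+w_t$ with $w_t\sim\mathcal N(0,\sigma_{\mathrm{DP}}^2I_d)$ independent of everything else; $\tilde g_t=(1-\kappa)\tilde g_{t-1}+\kappa g_t$; $x_{t+1}=x_t-\eta\tilde g_t$; $d_t=x_{t+1}-x_t$. Expectations are over all randomness (minibatches and noise). Assumptions: (A1) each $f(\cdot;\xi)$ is $L$-smooth, i.e. $\|\nabla f(x;\xi)-\nabla f(y;\xi)\|\le L\|x-y\|$ for all $x,y$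 and $\xi\in\mathcal D$; (A2) $\frac1N\sum_{\xi\in\mathcal D}\|\nabla f(x;\xi)-\nabla F(x)\|^2\le\sigma_{\mathrm{SGD}}^2$ for all $x$; (A3) $\|\nabla f(x;\xi)\|\le G$ for all $x$ and $\xi\in\mathcal D$. *)

theory Defs
  imports "HOL-Probability.Probability" "HOL-Probability.Product_PMF"
begin

text \<open>Clipping: clip(v,C) = min{1, C/||v||} v  (for v = 0 this gives 0).\<close>
definition clip :: "'a::real_normed_vector \<Rightarrow> real \<Rightarrow> 'a" where
  "clip v C = min 1 (C / norm v) *\<^sub>R v"

text \<open>State of DiSK after t steps: (x_t, d_{t-1}, tilde g_{t-1}).
  gf i is the gradient of the i-th loss; omega t = (b, w) where b j (j < B) are the
  indices of the minibatch samples and w is the Gaussian noise at step t.\<close>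
primrec disk_state ::
  "(nat \<Rightarrow> 'a::real_normed_vector \<Rightarrow> 'a) \<Rightarrow> nat \<Rightarrow> 'a \<Rightarrow> real \<Rightarrow> real \<Rightarrow> real \<Rightarrow> real
    \<Rightarrow> (nat \<Rightarrow> (nat \<Rightarrow> nat) \<times> 'a) \<Rightarrow> nat \<Rightarrow> 'a \<times> 'a \<times> 'a" where
  "disk_state gf B x0 \<eta> \<gamma> \<kappa> C \<omega> 0 = (x0, 0, 0)"
| "disk_state gf B x0 \<eta> \<gamma> \<kappa> C \<omega> (Suc t) =
     (let (x, dp, gp) = disk_state gf B x0 \<eta> \<gamma> \<kappa> C \<omega> t;
          b = fst (\<omega> t); w = snd (\<omega> t);
          a = (1 - \<kappa>) / (\<kappa> * \<gamma>);
          g = (1 / real B) *\<^sub>R (\<Sum>j<B. clip (a *\<^sub>R gf (b j) (x + \<gamma> *\<^sub>R dp) + (1 - a) *\<^sub>R gf (b j) x) C) + w;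
          gt = (1 - \<kappa>) *\<^sub>R gp + \<kappa> *\<^sub>R g;
          xn = x - \<eta> *\<^sub>R gt
      in (xn, xn - x, gt))"

definition disk_x ::
  "(nat \<Rightarrow> 'a::real_normed_vector \<Rightarrow> 'a) \<Rightarrow> nat \<Rightarrow> 'a \<Rightarrow> real \<Rightarrow> real \<Rightarrow> real \<Rightarrow> real
    \<Rightarrow> (nat \<Rightarrow> (nat \<Rightarrow> nat) \<times> 'a) \<Rightarrow> nat \<Rightarrow> 'a" where
  "disk_x gf B x0 \<eta> \<gamma> \<kappa> C \<omega> t = fst (disk_state gf B x0 \<eta> \<gamma> \<kappa> C \<omega> t)"

definition batch_measure :: "nat \<Rightarrow> nat \<Rightarrow> (nat \<Rightarrow> nat) measure" where
  "batch_measure N B = measure_pmf (Pi_pmf {..<B} 0 (\<lambda>_. pmf_of_set {..<N}))"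

definition gauss_vec :: "real \<Rightarrow> (real ^ 'd) measure" where
  "gauss_vec \<sigma> = (if \<sigma> = 0 then return borel 0
     else density lborel (\<lambda>w. ennreal (\<Prod>i\<in>UNIV. normal_density 0 \<sigma> (w $ i))))"

definition disk_space :: "nat \<Rightarrow> nat \<Rightarrow> real \<Rightarrow> nat \<Rightarrow> (nat \<Rightarrow> (nat \<Rightarrow> nat) \<times> (real ^ 'd)) measure" where
  "disk_space N B \<sigma> T = PiM {..<T} (\<lambda>_. batch_measure N B \<Otimes>\<^sub>M gauss_vec \<sigma>)"

end

theory Submission
  imports Defs
begin

text \<open>Write \<open>p\<close> for the current gradient estimate \<open>g\<close> tilde, \<open>x\<close> for the current point, \<open>d = - \<eta> p\<close> for the last
  displacement and \<open>r\<close>, \<open>q\<close> for the gradients of \<open>F\<close> at \<open>x - d\<close> and \<open>x\<close>. The potential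
  \<open>F x - Inf F + \<beta> (norm (p - r))\<^sup>2 + K (norm r)\<^sup>2\<close> decreases in expectation by \<open>(M1 \<eta> / 2) (norm q)\<^sup>2\<close> up to a
  constant amount of noise. Indeed the conditional mean of the new estimate is \<open>q + m\<close> with
  \<open>m = (1 - \<kappa>) (p - q + e)\<close>, where \<open>norm e\<close> and \<open>norm (r - q + e)\<close> are both of order \<open>L (norm d)\<close>.
  Expanding the descent lemma and the estimation error around \<open>q + m\<close> leaves a
  quadratic form in \<open>q\<close>, \<open>p - r\<close> and \<open>r - q + e\<close> that is nonnegative under the assumption on \<open>\<beta>\<close>.\<close>

section \<open>Clipping and the quadratic form\<close>

text \<open>The parameter conditions balance coefficients. Let h = \<open>1 - \<kappa>\<close>, l =
  \<open>\<eta> * L\<close>, X = \<open>(\<beta> + \<eta>\<^sup>2 * L) * h\<^sup>2\<close>, \<Delta>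
  = \<open>p - r\<close>. In units of X, the previous error \<Delta> is charged 1 directly,
  \<open>\<bar>1 + \<gamma>\<bar> * \<kappa>\<close> by Young's inequality for its product with the
  drift, and \<open>2 * l\<^sup>2 * R\<close> through \<open>(norm p)\<^sup>2 \<le> 2 * (norm
  \<Delta>)\<^sup>2 + 2 * (norm r)\<^sup>2\<close>, where
  \<open>R = 2 + \<bar>1 + \<gamma>\<bar> * M\<gamma>\<close>. These add up to Q, and
  \<open>\<eta> * h / 2 + X * Q \<le> \<beta>\<close> is the assumption on \<beta> without its
  denominator. The other half of the splitting costs \<open>K = 2 * X * l\<^sup>2 * R\<close> per
  unit of \<open>(norm r)\<^sup>2\<close>. The present q is the r of the next step, so this cost is
  deducted one step earlier, and
  \<open>\<eta> * (1 + \<kappa> - 2 * l) / 2 - K = M1 * \<eta> / 2\<close> remains.\<close>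

lemma clip_eq_self: "norm v \<le> C \<Longrightarrow> clip v C = v"
  by (cases "v = 0") (auto simp: clip_def field_simps min_def)

text \<open>The obtuse-angle property of a projection: \<open>u - clip u C\<close> and
  \<open>clip u C - w\<close> have nonnegative inner product, by Cauchy-Schwarz and
  \<open>norm w \<le> C\<close>. Only \<open>w\<close> has to lie in the ball.\<close>

lemma norm_clip_diff_le:
  fixes u w :: "'a::real_inner"
  assumes "norm w \<le> C"
  shows "norm (clip u C - w) \<le> norm (u - w)"
proof (cases "norm u \<le> C")
  case True
  then show ?thesis by (simp add: clip_eq_self)
next
  case False
  have C0: "0 \<le> C" using assms norm_ge_zero order_trans by blast
  then have u0: "norm u > 0" using False by linarith
  define t where "t = C / norm u"
  have t: "0 \<le> t" "t < 1" "t * norm u = C"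
    using False C0 u0 by (auto simp: t_def field_simps)
  have cl: "clip u C = t *\<^sub>R u" using t by (simp add: clip_def t_def)
  have "inner u w \<le> norm u * C"
    using assms mult_left_mono[OF assms norm_ge_zero[of u]] norm_cauchy_schwarz[of u w] by linarith
  also have "\<dots> = t * (norm u)\<^sup>2" using t(3) by (simp add: power2_eq_square)
  finally have "0 \<le> (1 - t) * (t * inner u u - inner u w)"
    using t by (intro mult_nonneg_nonneg) (auto simp: dot_square_norm)
  then have "0 \<le> 2 * inner (u - t *\<^sub>R u) (t *\<^sub>R u - w)"
    by (simp add: algebra_simps inner_diff_left inner_diff_right)
  moreover have "(norm (u - w))\<^sup>2 = (norm (u - t *\<^sub>R u))\<^sup>2 + (norm (t *\<^sub>R u - w))\<^sup>2
      + 2 * inner (u - t *\<^sub>R u) (t *\<^sub>R u - w)"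
    unfolding power2_norm_eq_inner
    by (simp add: inner_diff_left inner_diff_right inner_commute algebra_simps)
  ultimately have "(norm (t *\<^sub>R u - w))\<^sup>2 \<le> (norm (u - w))\<^sup>2"
    using zero_le_power2[of "norm (u - t *\<^sub>R u)"] by linarith
  then show ?thesis unfolding cl by (rule power2_le_imp_le) simp
qed

text \<open>The correction \<open>e\<close> plays the role of the unclipped finite difference
  \<open>(g (x + \<gamma> d) - g x) / \<gamma>\<close>. If \<open>\<bar>\<gamma>\<bar> < 1\<close>, clipping may really occur. It does no harm, since clipping is
  the projection onto a ball and the points it is compared with, \<open>g x\<close> and
  \<open>g x - ((1 - \<kappa>) / \<kappa>) (g y - g x)\<close>, lie in that ball.\<close>
lemma clipped_correction:
  fixes g :: "'a::real_inner \<Rightarrow> 'a"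
  assumes lip: "\<And>x y. norm (g x - g y) \<le> L * norm (x - y)"
    and bnd: "\<And>x. norm (g x) \<le> G"
    and \<kappa>: "0 < \<kappa>" "\<kappa> \<le> 1" and \<gamma>: "\<gamma> \<noteq> 0"
    and C: "C \<ge> (1 + 2 * (1 - \<kappa>) / \<kappa>) * G"
    and a: "a = (1 - \<kappa>) / (\<kappa> * \<gamma>)"
  shows "\<exists>e. \<kappa> *\<^sub>R clip (a *\<^sub>R g (x + \<gamma> *\<^sub>R d) + (1 - a) *\<^sub>R g x) C = \<kappa> *\<^sub>R g x + (1 - \<kappa>) *\<^sub>R e
      \<and> norm e \<le> L * norm d
      \<and> norm (g (x - d) - g x + e) \<le> 2 * (\<bar>1 + \<gamma>\<bar> / \<bar>\<gamma>\<bar>) * (L * norm d)"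
proof -
  define D where "D = (1 / \<gamma>) *\<^sub>R (g (x + \<gamma> *\<^sub>R d) - g x)"
  define u where "u = a *\<^sub>R g (x + \<gamma> *\<^sub>R d) + (1 - a) *\<^sub>R g x"
  define h where "h = 1 - \<kappa>"
  have h0: "h \<ge> 0" using \<kappa> by (simp add: h_def)
  have G0: "G \<ge> 0" using bnd norm_ge_zero order_trans by blast
  have hk: "h / \<kappa> \<ge> 0" using h0 \<kappa> by simp
  have u: "u = g x + (h / \<kappa>) *\<^sub>R D"
    using \<gamma> \<kappa> by (simp add: u_def D_def a h_def algebra_simps)
  have GC: "G + 2 * (h / \<kappa>) * G \<le> C" using C by (simp add: h_def algebra_simps)
  have in_ball: "norm (g x - (h / \<kappa>) *\<^sub>R (g y - g x)) \<le> C" for y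
  proof -
    have "norm (g x - (h / \<kappa>) *\<^sub>R (g y - g x)) \<le> norm (g x) + (h / \<kappa>) * norm (g y - g x)"
      using hk by (metis abs_of_nonneg norm_scaleR norm_triangle_ineq4)
    also have "\<dots> \<le> G + (h / \<kappa>) * (2 * G)"
      using norm_triangle_ineq4[of "g y" "g x"] bnd[of x] bnd[of y]
      by (intro add_mono mult_left_mono hk) auto
    finally show ?thesis using GC by (simp add: mult.commute mult.left_commute)
  qed
  have gx: "norm (g x) \<le> C" using in_ball[of x] by simp
  have D: "norm D \<le> L * norm d"
  proof -
    have "norm (g (x + \<gamma> *\<^sub>R d) - g x) \<le> L * (\<bar>\<gamma>\<bar> * norm d)"
      using lip[of "x + \<gamma> *\<^sub>R d" x] by simp
    moreover have "norm D = norm (g (x + \<gamma> *\<^sub>R d) - g x) / \<bar>\<gamma>\<bar>" by (simp add: D_def)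
    ultimately show ?thesis using \<gamma> by (simp add: divide_le_eq mult_ac)
  qed
  have sD: "norm (g (x - d) - g x + D) \<le> 2 * (\<bar>1 + \<gamma>\<bar> / \<bar>\<gamma>\<bar>) * (L * norm d)"
  proof -
    \<comment> \<open>The origin of the factor \<open>\<bar>1 + \<gamma>\<bar>\<close>: the points
      \<open>x + \<gamma> *\<^sub>R d\<close> and \<open>x - d\<close> coincide for \<gamma> = -1
      and are \<open>\<bar>1 + \<gamma>\<bar> * norm d\<close> apart in general. The second summand
      has the same factor, hence the 2 in the bound.\<close>
    have eq: "g (x - d) - g x + D =
      (1 / \<gamma>) *\<^sub>R (g (x + \<gamma> *\<^sub>R d) - g (x - d)) + ((1 + \<gamma>) / \<gamma>) *\<^sub>R (g (x - d) - g x)"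
      using \<gamma> by (simp add: D_def algebra_simps add_divide_distrib)
    have 1: "norm (g (x + \<gamma> *\<^sub>R d) - g (x - d)) \<le> L * (\<bar>1 + \<gamma>\<bar> * norm d)"
    proof -
      have "x + \<gamma> *\<^sub>R d - (x - d) = (1 + \<gamma>) *\<^sub>R d" by (simp add: algebra_simps)
      then show ?thesis using lip[of "x + \<gamma> *\<^sub>R d" "x - d"] by simp
    qed
    have 2: "norm (g (x - d) - g x) \<le> L * norm d" using lip[of "x - d" x] by simp
    have "norm (g (x - d) - g x + D) \<le> (1 / \<bar>\<gamma>\<bar>) * norm (g (x + \<gamma> *\<^sub>R d) - g (x - d))
       + (\<bar>1 + \<gamma>\<bar> / \<bar>\<gamma>\<bar>) * norm (g (x - d) - g x)"
      unfolding eq by (rule order_trans[OF norm_triangle_ineq]) simp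
    also have "\<dots> \<le> (1 / \<bar>\<gamma>\<bar>) * (L * (\<bar>1 + \<gamma>\<bar> * norm d)) + (\<bar>1 + \<gamma>\<bar> / \<bar>\<gamma>\<bar>) * (L * norm d)"
      by (intro add_mono mult_left_mono 1 2) auto
    also have "\<dots> = 2 * (\<bar>1 + \<gamma>\<bar> / \<bar>\<gamma>\<bar>) * (L * norm d)" by simp
    finally show ?thesis .
  qed
  show ?thesis
  proof (cases "h = 0")
    \<comment> \<open>For \<kappa> = 1 the correction has weight 0 and cannot be recovered from the
      clipped value, so \<open>D\<close> itself is the witness. Nothing is clipped, as
      \<open>u = g x\<close>.\<close>
    case True
    then have "\<kappa> = 1" by (simp add: h_def)
    with True show ?thesis
      using u gx D sD unfolding u_def[symmetric] by (intro exI[of _ D]) (simp add: clip_eq_self)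
  next
    case False
    then have h: "h > 0" using h0 by simp
    define e where "e = (\<kappa> / h) *\<^sub>R (clip u C - g x)"
    have "\<kappa> *\<^sub>R clip u C = \<kappa> *\<^sub>R g x + h *\<^sub>R e"
      using h by (simp add: e_def algebra_simps)
    \<comment> \<open>Nonexpansiveness towards the ball point
      \<open>g x - (h / \<kappa>) *\<^sub>R v\<close>, rescaled by \<open>\<kappa> / h\<close>. The
      two required bounds are the instances \<open>v = 0\<close> and
      \<open>v = g (x - d) - g x\<close>.\<close>
    moreover have *: "norm (v + e) \<le> norm (v + D)" if "norm (g x - (h / \<kappa>) *\<^sub>R v) \<le> C" for v
    proof -
      have "v + e = (\<kappa> / h) *\<^sub>R (clip u C - (g x - (h / \<kappa>) *\<^sub>R v))"
        using h \<kappa> by (simp add: e_def algebra_simps)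
      then have "norm (v + e) = (\<kappa> / h) * norm (clip u C - (g x - (h / \<kappa>) *\<^sub>R v))"
        using h \<kappa> by simp
      also have "\<dots> \<le> (\<kappa> / h) * norm (u - (g x - (h / \<kappa>) *\<^sub>R v))"
        using h \<kappa> that by (intro mult_left_mono norm_clip_diff_le) auto
      also have "\<dots> = norm ((\<kappa> / h) *\<^sub>R (u - (g x - (h / \<kappa>) *\<^sub>R v)))" using h \<kappa> by simp
      also have "(\<kappa> / h) *\<^sub>R (u - (g x - (h / \<kappa>) *\<^sub>R v)) = v + D"
        using h \<kappa> by (simp add: u algebra_simps)
      finally show ?thesis .
    qed
    have "norm e \<le> L * norm d" using *[of 0] gx D by simp
    moreover have "norm (g (x - d) - g x + e) \<le> 2 * (\<bar>1 + \<gamma>\<bar> / \<bar>\<gamma>\<bar>) * (L * norm d)"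
      using *[OF in_ball] sD by (meson order_trans)
    ultimately show ?thesis unfolding u_def[symmetric] h_def by blast
  qed
qed

text \<open>Here \<open>h = 1 - \<kappa>\<close>, \<open>l = \<eta> L\<close>, \<open>\<Delta>\<close> is the error of the previous gradient estimate and \<open>s\<close> the
  drift of the true gradient left over by the correction. For \<open>l \<ge> 1/3\<close> the square is completed in
  \<open>q - h (\<Delta> + s)\<close>. For smaller \<open>l\<close> the last summand is dropped and the first one
  pays for \<open>h inner q s\<close>.\<close>
lemma key_quadratic_inequality:
  fixes q \<Delta> s p :: "'a::real_inner"
  assumes l: "0 < l" "l < 1" "l \<le> c" and h: "0 \<le> h" "h \<le> 1"
    and z: "(1 - l) * norm p \<le> norm (q + \<Delta>)"
    and s: "norm s \<le> 2 * l * norm p"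
    and W: "2 * norm \<Delta> * norm s \<le> W"
  shows "0 \<le> h / 2 * (norm (q + \<Delta>))\<^sup>2 + h * inner q s + l / 2 * (norm (q - h *\<^sub>R (\<Delta> + s)))\<^sup>2
     + c * h\<^sup>2 * (W - 2 * inner \<Delta> s)"
proof -
  define i where "i = inner \<Delta> s"
  have iW: "2 * \<bar>i\<bar> \<le> W"
    using W Cauchy_Schwarz_ineq2[of \<Delta> s] by (simp add: i_def)
  have z2: "(1 - l)\<^sup>2 * (norm p)\<^sup>2 \<le> (norm (q + \<Delta>))\<^sup>2"
    using power_mono[OF z, of 2] l by (simp add: power_mult_distrib)
  have s2: "(norm s)\<^sup>2 \<le> 4 * l\<^sup>2 * (norm p)\<^sup>2"
    using power_mono[OF s, of 2] by (simp add: power_mult_distrib)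
  show ?thesis
  \<comment> \<open>Any threshold from 1/4 to 1/3 would do. The first case needs
    \<open>c \<ge> 1/4\<close>, which comes from \<open>c \<ge> l\<close>; the second needs
    \<open>4 * l \<le> 3 * (1 - l)\<^sup>2\<close>, whose smaller root is 1/3.\<close>
  proof (cases "l \<ge> 1/3")
    case True
    have "0 \<le> l / 2 * (norm (q - h *\<^sub>R (\<Delta> + s) + (h / l) *\<^sub>R s))\<^sup>2" using l by simp
    also have "\<dots> = l / 2 * (norm (q - h *\<^sub>R (\<Delta> + s)))\<^sup>2 + h * inner q s
        - h\<^sup>2 * i + h\<^sup>2 * (1 / (2 * l) - 1) * (norm s)\<^sup>2"
      using l unfolding power2_norm_eq_inner i_def
      by (simp add: inner_add_left inner_add_right inner_diff_left inner_diff_right inner_commute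
          field_simps power2_eq_square)
    finally have 1: "h\<^sup>2 * i - h\<^sup>2 * ((1 / (2 * l) - 1) * (norm s)\<^sup>2)
       \<le> l / 2 * (norm (q - h *\<^sub>R (\<Delta> + s)))\<^sup>2 + h * inner q s" by simp
    have 2: "(1 / (2 * l) - 1) * (norm s)\<^sup>2 \<le> (norm (q + \<Delta>))\<^sup>2 / 2"
    proof (cases "1 / (2 * l) \<le> 1")
      case True
      then have "(1 / (2 * l) - 1) * (norm s)\<^sup>2 \<le> 0" by (intro mult_nonpos_nonneg) auto
      then show ?thesis by (meson order_trans divide_nonneg_nonneg zero_le_power2 zero_le_numeral)
    next
      case False
      then have "(1 / (2 * l) - 1) * (norm s)\<^sup>2 \<le> (1 / (2 * l) - 1) * (4 * l\<^sup>2 * (norm p)\<^sup>2)"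
        by (intro mult_left_mono s2) auto
      also have "\<dots> = (2 * l - 4 * l\<^sup>2) * (norm p)\<^sup>2" using l by (simp add: field_simps power2_eq_square)
      also have "\<dots> \<le> ((1 - l)\<^sup>2 / 2) * (norm p)\<^sup>2"
      proof (rule mult_right_mono)
        have "0 \<le> (3 * l - 1)\<^sup>2" by simp
        then show "2 * l - 4 * l\<^sup>2 \<le> (1 - l)\<^sup>2 / 2" by (simp add: power2_eq_square algebra_simps)
      qed simp
      finally show ?thesis using z2 by simp
    qed
    have 3: "h\<^sup>2 * ((norm (q + \<Delta>))\<^sup>2 / 2) \<le> h / 2 * (norm (q + \<Delta>))\<^sup>2"
    proof -
      have "h\<^sup>2 \<le> h" using h by (simp add: power2_eq_square mult_left_le)
      then show ?thesis using mult_right_mono[of "h\<^sup>2" h "(norm (q + \<Delta>))\<^sup>2 / 2"] by simp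
    qed
    \<comment> \<open>The inner product left over from completing the square. When it is negative,
      \<open>W\<close> and \<open>- 2 * i\<close> contribute at least
      \<open>2 * \<bar>i\<bar>\<close> each, so a quarter of their sum compensates it.\<close>
    have 4: "0 \<le> c * (W - 2 * i) + i"
    proof (cases "i \<ge> 0")
      case True then show ?thesis using iW l by (intro add_nonneg_nonneg mult_nonneg_nonneg) auto
    next
      case False
      then have "c * (W - 2 * i) \<ge> (1/4) * (- 4 * i)"
        using iW l \<open>l \<ge> 1/3\<close> by (intro mult_mono) auto
      then show ?thesis by simp
    qed
    have "0 \<le> h\<^sup>2 * (c * (W - 2 * i) + i)" using 4 by simp
    moreover have "h\<^sup>2 * ((1 / (2 * l) - 1) * (norm s)\<^sup>2) \<le> h\<^sup>2 * ((norm (q + \<Delta>))\<^sup>2 / 2)"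
      by (intro mult_left_mono 2) auto
    ultimately show ?thesis using 1 3 unfolding i_def[symmetric] by (simp add: algebra_simps)
  next
    case False
    define z where "z = q + \<Delta>"
    define y where "y = q - h *\<^sub>R (\<Delta> + s)"
    \<comment> \<open>Eliminating \<Delta> writes \<open>q\<close> through the two vectors whose
      squares are available. Thus \<open>inner q s\<close> splits into \<open>inner y s\<close> and
      \<open>inner z s\<close>, and each is absorbed by a square of its own (\<open>A\<close> and
      \<open>B\<close>). Multiplying by \<open>2 * l * (1 + h)\<^sup>2\<close> below only clears
      denominators.\<close>
    have q: "(1 + h) *\<^sub>R q = y + h *\<^sub>R z + h *\<^sub>R s" by (simp add: y_def z_def algebra_simps)
    have iq: "(1 + h) * inner q s = inner y s + h * inner z s + h * (norm s)\<^sup>2"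
      using arg_cong[OF q, of "\<lambda>v. inner v s"] by (simp add: inner_add_left power2_norm_eq_inner)
    have A: "0 \<le> (l * (1 + h))\<^sup>2 * (norm y)\<^sup>2 + 2 * l * (1 + h) * h * inner y s + h\<^sup>2 * (norm s)\<^sup>2"
    proof -
      have "0 \<le> (norm ((l * (1 + h)) *\<^sub>R y + h *\<^sub>R s))\<^sup>2" by simp
      also have "\<dots> = (l * (1 + h))\<^sup>2 * (norm y)\<^sup>2 + 2 * l * (1 + h) * h * inner y s + h\<^sup>2 * (norm s)\<^sup>2"
        unfolding power2_norm_eq_inner
        by (simp add: inner_add_left inner_add_right inner_commute power2_eq_square algebra_simps)
      finally show ?thesis .
    qed
    have B: "0 \<le> (norm z)\<^sup>2 / 4 + inner z s + (norm s)\<^sup>2"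
    proof -
      have "0 \<le> (norm ((1/2) *\<^sub>R z + s))\<^sup>2" by simp
      also have "\<dots> = (norm z)\<^sup>2 / 4 + inner z s + (norm s)\<^sup>2"
        unfolding power2_norm_eq_inner
        by (simp add: inner_add_left inner_add_right inner_commute power2_eq_square algebra_simps)
      finally show ?thesis .
    qed
    \<comment> \<open>The constant 3 is the largest one that the remaining multiple of
      \<open>(norm z)\<^sup>2\<close> can pay for all \<open>h\<close> up to 1: the final comparison
      reduces to \<open>(1 - h) * (2 - h) \<ge> 0\<close>, an equality at
      \<open>h = 1\<close>.\<close>
    have S: "(norm s)\<^sup>2 \<le> 3 * l * (norm z)\<^sup>2"
    proof -
      have "4 * l \<le> 3 * (1 - l)\<^sup>2"
      proof -
        have "0 \<le> (1 - 3 * l) * (3 - l)" using False l by (intro mult_nonneg_nonneg) auto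
        then show ?thesis by (simp add: power2_eq_square algebra_simps)
      qed
      then have "l * (4 * l) * (norm p)\<^sup>2 \<le> l * (3 * (1 - l)\<^sup>2) * (norm p)\<^sup>2"
        using l by (intro mult_right_mono mult_left_mono) auto
      also have "\<dots> = 3 * l * ((1 - l)\<^sup>2 * (norm p)\<^sup>2)" by simp
      also have "\<dots> \<le> 3 * l * (norm z)\<^sup>2" using z2 l unfolding z_def by (intro mult_left_mono) auto
      finally show ?thesis using s2 by (simp add: power2_eq_square)
    qed
    have cW: "0 \<le> c * h\<^sup>2 * (W - 2 * inner \<Delta> s)"
      using iW l unfolding i_def by (intro mult_nonneg_nonneg) auto
    define E where "E = h / 2 * (norm z)\<^sup>2 + h * inner q s + l / 2 * (norm y)\<^sup>2"
    have "2 * l * (1 + h)\<^sup>2 * E = h * l * (1 + h)\<^sup>2 * (norm z)\<^sup>2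
        + 2 * l * (1 + h) * h * ((1 + h) * inner q s) + (l * (1 + h))\<^sup>2 * (norm y)\<^sup>2"
      by (simp add: E_def power2_eq_square algebra_simps)
    also have "\<dots> = ((l * (1 + h))\<^sup>2 * (norm y)\<^sup>2 + 2 * l * (1 + h) * h * inner y s + h\<^sup>2 * (norm s)\<^sup>2)
       + 2 * l * (1 + h) * h\<^sup>2 * ((norm z)\<^sup>2 / 4 + inner z s + (norm s)\<^sup>2)
       + h * (l * ((1 + h)\<^sup>2 - (1 + h) * h / 2) * (norm z)\<^sup>2 - h * (norm s)\<^sup>2)"
      unfolding iq by (simp add: power2_eq_square field_simps)
    also have "\<dots> \<ge> 0"
    proof (rule add_nonneg_nonneg[OF add_nonneg_nonneg[OF A mult_nonneg_nonneg[OF _ B]] mult_nonneg_nonneg])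
      have "h * (norm s)\<^sup>2 \<le> h * (3 * l * (norm z)\<^sup>2)" using S h by (intro mult_left_mono) auto
      also have "\<dots> = l * (3 * h) * (norm z)\<^sup>2" by simp
      also have "\<dots> \<le> l * ((1 + h)\<^sup>2 - (1 + h) * h / 2) * (norm z)\<^sup>2"
      proof (intro mult_right_mono mult_left_mono)
        have "0 \<le> (1 - h) * (2 - h)" using h by simp
        then show "3 * h \<le> (1 + h)\<^sup>2 - (1 + h) * h / 2" by (simp add: power2_eq_square field_simps)
      qed (use l in auto)
      finally show "0 \<le> l * ((1 + h)\<^sup>2 - (1 + h) * h / 2) * (norm z)\<^sup>2 - h * (norm s)\<^sup>2" by simp
    qed (use l h in auto)
    finally have "0 \<le> (2 * l * (1 + h)\<^sup>2) * E" .
    moreover have "0 < 2 * l * (1 + h)\<^sup>2" using l h by simp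
    ultimately have "0 \<le> E" by (simp only: zero_le_mult_iff) linarith
    then show ?thesis using cW unfolding E_def z_def y_def by linarith
  qed
qed

text \<open>Young's inequality with weight \<open>\<delta> * \<kappa>\<close> on
  \<open>D\<^sup>2\<close> leaves \<open>S\<^sup>2 / (\<delta> * \<kappa>)\<close>. Since
  \<open>S\<close> is itself of order \<delta>, this is only of order \<delta>, and
  \<open>(1 + 1 / (\<delta> * \<kappa>)) * S\<^sup>2\<close> is covered by
  \<open>\<delta> * M\<gamma> * (l * P)\<^sup>2\<close>. The term \<open>- S\<^sup>2\<close> on the
  right is kept to cancel the square of the drift when \<open>\<Delta> + s\<close> is expanded. The
  weight degenerates at \<delta> = 0, where \<open>S\<close> vanishes.\<close>

lemma young_absorbs_correction:
  fixes D S P \<delta> \<kappa> \<gamma> l :: real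
  assumes "0 \<le> \<delta>" "0 < \<kappa>" "\<gamma> \<noteq> 0" "0 \<le> S"
    and S: "S \<le> 2 * (\<delta> / \<bar>\<gamma>\<bar>) * (l * P)"
  shows "2 * D * S \<le> \<delta> * \<kappa> * D\<^sup>2 + l\<^sup>2 * (\<delta> * (1 + 4 * (2 + 1 / \<kappa> + \<delta>) / \<gamma>\<^sup>2)) * P\<^sup>2 - S\<^sup>2"
proof (cases "\<delta> = 0")
  case True
  then have "S = 0" using assms by simp
  then show ?thesis using True by simp
next
  case False
  then have \<delta>: "\<delta> > 0" using assms by simp
  have "S\<^sup>2 \<le> (2 * (\<delta> / \<bar>\<gamma>\<bar>) * (l * P))\<^sup>2" using S assms by (intro power_mono) auto
  also have "\<dots> = 4 * \<delta>\<^sup>2 / \<gamma>\<^sup>2 * (l * P)\<^sup>2" by (simp add: power_mult_distrib power_divide)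
  finally have S2: "S\<^sup>2 \<le> 4 * \<delta>\<^sup>2 / \<gamma>\<^sup>2 * (l * P)\<^sup>2" .
  have "S\<^sup>2 + S\<^sup>2 / (\<delta> * \<kappa>) = (1 + 1 / (\<delta> * \<kappa>)) * S\<^sup>2" by (simp add: distrib_right)
  also have "\<dots> \<le> (1 + 1 / (\<delta> * \<kappa>)) * (4 * \<delta>\<^sup>2 / \<gamma>\<^sup>2 * (l * P)\<^sup>2)"
    using S2 \<delta> assms by (intro mult_left_mono) auto
  also have "\<dots> = (4 * \<delta>\<^sup>2 / \<gamma>\<^sup>2 + 4 * \<delta> / (\<kappa> * \<gamma>\<^sup>2)) * (l * P)\<^sup>2"
    using \<delta> assms by (simp add: field_simps power2_eq_square)
  also have "\<dots> \<le> (\<delta> * (1 + 4 * (2 + 1 / \<kappa> + \<delta>) / \<gamma>\<^sup>2)) * (l * P)\<^sup>2"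
  proof (rule mult_right_mono)
    have "\<delta> * (1 + 4 * (2 + 1 / \<kappa> + \<delta>) / \<gamma>\<^sup>2) = 4 * \<delta>\<^sup>2 / \<gamma>\<^sup>2 + 4 * \<delta> / (\<kappa> * \<gamma>\<^sup>2) + (\<delta> + 8 * \<delta> / \<gamma>\<^sup>2)"
      using assms by (simp add: field_simps power2_eq_square)
    moreover have "0 \<le> \<delta> + 8 * \<delta> / \<gamma>\<^sup>2" using \<delta> by simp
    ultimately show "4 * \<delta>\<^sup>2 / \<gamma>\<^sup>2 + 4 * \<delta> / (\<kappa> * \<gamma>\<^sup>2) \<le> \<delta> * (1 + 4 * (2 + 1 / \<kappa> + \<delta>) / \<gamma>\<^sup>2)" by linarith
  qed simp
  finally have 1: "S\<^sup>2 + S\<^sup>2 / (\<delta> * \<kappa>) \<le> l\<^sup>2 * (\<delta> * (1 + 4 * (2 + 1 / \<kappa> + \<delta>) / \<gamma>\<^sup>2)) * P\<^sup>2"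
    by (simp only: power_mult_distrib mult_ac)
  have "0 \<le> \<delta> * \<kappa> * (D - S / (\<delta> * \<kappa>))\<^sup>2" using \<delta> assms by simp
  also have "\<dots> = \<delta> * \<kappa> * D\<^sup>2 - 2 * D * S + S\<^sup>2 / (\<delta> * \<kappa>)"
    using \<delta> assms by (simp add: field_simps power2_eq_square)
  finally show ?thesis using 1 by linarith
qed

text \<open>Three gains feed the quadratic form. The parallelogram law for \<open>q + m\<close>
  yields \<open>- (norm (q - m))\<^sup>2\<close>; completing the square in
  \<open>- inner q \<Delta>\<close> yields \<open>- (norm (q + \<Delta>))\<^sup>2\<close> at the
  price of \<open>\<eta> * h / 2 * (norm \<Delta>)\<^sup>2\<close>; and \<open>W\<close> pays for
  the cross term of \<Delta> and \<open>s\<close>. What is left over \<open>q\<close> alone is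
  \<open>\<eta> - \<eta> * h / 2 - \<eta> * l\<close>, which is the coefficient
  \<open>\<eta> * (1 + \<kappa> - 2 * \<eta> * L) / 2\<close>.\<close>

lemma lyapunov_drift:
  fixes q r p e :: "'a::real_inner"
  assumes l: "0 < \<eta>" "0 < L" "\<eta> * L < 1" and \<kappa>: "0 < \<kappa>" "\<kappa> \<le> 1" and \<gamma>: "\<gamma> \<noteq> 0" and \<beta>: "0 \<le> \<beta>"
    and R: "R = 2 + \<bar>1 + \<gamma>\<bar> * (1 + 4 * (2 + 1 / \<kappa> + \<bar>1 + \<gamma>\<bar>) / \<gamma>\<^sup>2)"
    and \<beta>_bound: "\<eta> * (1 - \<kappa>) / 2 + \<eta>\<^sup>2 * L * (1 - \<kappa>)\<^sup>2 * Q \<le> \<beta> * (1 - (1 - \<kappa>)\<^sup>2 * Q)"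
    and Q: "Q = 1 + \<bar>1 + \<gamma>\<bar> * \<kappa> + 2 * (\<eta> * L)\<^sup>2 * R"
    and qr: "norm (q - r) \<le> \<eta> * L * norm p" and e: "norm e \<le> \<eta> * L * norm p"
    and s: "norm (r - q + e) \<le> 2 * (\<bar>1 + \<gamma>\<bar> / \<bar>\<gamma>\<bar>) * (\<eta> * L * norm p)"
    and k: "k = (if p = 0 then 0 else 2 * (\<beta> + \<eta>\<^sup>2 * L) * (1 - \<kappa>)\<^sup>2 * (\<eta> * L)\<^sup>2 * R)"
    and m: "m = (1 - \<kappa>) *\<^sub>R (p - q + e)"
  shows "\<eta> * (1 + \<kappa> - 2 * \<eta> * L) / 2 * (norm q)\<^sup>2
      - \<eta> * inner q (q + m) + L * \<eta>\<^sup>2 / 2 * (norm (q + m))\<^sup>2 + \<beta> * (norm m)\<^sup>2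
      + (\<beta> + L * \<eta>\<^sup>2 / 2) * (2 * (1 - \<kappa>)\<^sup>2 * (\<eta> * L)\<^sup>2 * (norm p)\<^sup>2)
      \<le> \<beta> * (norm (p - r))\<^sup>2 + k * (norm r)\<^sup>2"
proof -
  define h where "h = 1 - \<kappa>"
  define l where "l = \<eta> * L"
  define \<delta> where "\<delta> = \<bar>1 + \<gamma>\<bar>"
  define \<Delta> where "\<Delta> = p - r"
  define s where "s = r - q + e"
  define X where "X = (\<beta> + \<eta> * l) * h\<^sup>2"
  \<comment> \<open>Only \<open>R - 2\<close> appears here. The other 2 in \<open>R\<close> is
    reserved for the minibatch variance of the corrections, the last summand on the left of the
    claim (see \<open>f3\<close>).\<close>
  define W where "W = \<delta> * \<kappa> * (norm \<Delta>)\<^sup>2 + l\<^sup>2 * (R - 2) * (norm p)\<^sup>2 - (norm s)\<^sup>2"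
  have \<delta>0: "\<delta> \<ge> 0" and l0: "0 < l" "l < 1" and h01: "0 \<le> h" "h \<le> 1"
    using l \<kappa> by (auto simp: \<delta>_def l_def h_def)
  have R0: "0 \<le> R"
  proof -
    have "0 \<le> 4 * (2 + 1 / \<kappa> + \<delta>) / \<gamma>\<^sup>2" using \<kappa> \<delta>0 by simp
    then show ?thesis unfolding R \<delta>_def[symmetric] using \<delta>0 by simp
  qed
  have X0: "0 \<le> X" using \<beta> l l0 by (simp add: X_def)
  have m': "m = h *\<^sub>R (\<Delta> + s)" by (simp add: m h_def \<Delta>_def s_def)
  have c: "l \<le> \<beta> / \<eta> + l" using \<beta> l by simp
  \<comment> \<open>This makes the drift controllable: \<open>q + \<Delta>\<close> is
    \<open>p\<close> perturbed by the change of gradient along a step proportional to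
    \<open>p\<close>, so a small \<open>q + \<Delta>\<close> forces a small \<open>p\<close>, and
    with it a small \<open>s\<close>.\<close>
  have z: "(1 - l) * norm p \<le> norm (q + \<Delta>)"
  proof -
    have "norm p - norm (q - r) \<le> norm (p + (q - r))" by (rule norm_diff_ineq)
    moreover have "p + (q - r) = q + \<Delta>" by (simp add: \<Delta>_def)
    ultimately show ?thesis using qr by (simp add: l_def algebra_simps)
  qed
  have s2: "norm s \<le> 2 * l * norm p"
    using norm_triangle_ineq[of "r - q" e] qr e by (simp add: s_def l_def norm_minus_commute)
  have W: "2 * norm \<Delta> * norm s \<le> W"
    using young_absorbs_correction[of \<delta> \<kappa> \<gamma> "norm s" l "norm p" "norm \<Delta>"] \<delta>0 \<kappa> \<gamma> s
    by (simp add: W_def R \<delta>_def l_def s_def)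
  have "0 \<le> \<eta> * (h / 2 * (norm (q + \<Delta>))\<^sup>2 + h * inner q s + l / 2 * (norm (q - m))\<^sup>2
     + (\<beta> / \<eta> + l) * h\<^sup>2 * (W - 2 * inner \<Delta> s))"
    using key_quadratic_inequality[OF l0 c h01 z s2 W] l unfolding m' by simp
  also have "\<dots> = \<eta> * h / 2 * (norm (q + \<Delta>))\<^sup>2 + \<eta> * h * inner q s + \<eta> * l / 2 * (norm (q - m))\<^sup>2
     + X * W - 2 * X * inner \<Delta> s"
    using l by (simp add: X_def field_simps)
  finally have key: "0 \<le> \<eta> * h / 2 * (norm (q + \<Delta>))\<^sup>2 + \<eta> * h * inner q s + \<eta> * l / 2 * (norm (q - m))\<^sup>2
     + X * W - 2 * X * inner \<Delta> s" .
  have f1: "\<eta> * h / 2 * (norm \<Delta>)\<^sup>2 + X * Q * (norm \<Delta>)\<^sup>2 \<le> \<beta> * (norm \<Delta>)\<^sup>2"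
  proof -
    have "\<eta> * h / 2 + X * Q \<le> \<beta>"
      using \<beta>_bound by (simp add: X_def h_def l_def algebra_simps power2_eq_square)
    then show ?thesis using mult_right_mono[of "\<eta> * h / 2 + X * Q" \<beta> "(norm \<Delta>)\<^sup>2"]
      by (simp add: distrib_right)
  qed
  \<comment> \<open>The \<Delta> part of the splitting enters \<open>Q\<close>, the \<open>r\<close>
    part is the weight \<open>K\<close>. For \<open>p = 0\<close> there is nothing to split, which
    is why the weight may be switched off then.\<close>
  have f2: "X * (l\<^sup>2 * R) * (norm p)\<^sup>2 \<le> 2 * X * (l\<^sup>2 * R) * (norm \<Delta>)\<^sup>2 + k * (norm r)\<^sup>2"
  proof (cases "p = 0")
    case True then show ?thesis using X0 R0 k by simp
  next
    case False
    have "(norm p)\<^sup>2 \<le> 2 * (norm \<Delta>)\<^sup>2 + 2 * (norm r)\<^sup>2"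
    proof -
      have "0 \<le> (norm (\<Delta> - r))\<^sup>2" by simp
      moreover have "p = \<Delta> + r" by (simp add: \<Delta>_def)
      ultimately show ?thesis
        by (simp add: power2_norm_eq_inner inner_add_left inner_add_right inner_diff_left inner_diff_right inner_commute)
    qed
    then have "X * (l\<^sup>2 * R) * (norm p)\<^sup>2 \<le> X * (l\<^sup>2 * R) * (2 * (norm \<Delta>)\<^sup>2 + 2 * (norm r)\<^sup>2)"
      using X0 R0 by (intro mult_left_mono) auto
    also have "\<dots> = 2 * X * (l\<^sup>2 * R) * (norm \<Delta>)\<^sup>2 + k * (norm r)\<^sup>2"
      using False by (simp add: k X_def h_def l_def algebra_simps power2_eq_square)
    finally show ?thesis .
  qed
  have nm: "(\<beta> + \<eta> * l) * (norm m)\<^sup>2 = X * (norm \<Delta>)\<^sup>2 + 2 * X * inner \<Delta> s + X * (norm s)\<^sup>2"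
    unfolding m' X_def
    by (simp add: power_mult_distrib) (simp add: power2_norm_eq_inner inner_add_left inner_add_right inner_commute algebra_simps)
  have qm: "inner q m = h * inner q \<Delta> + h * inner q s" by (simp add: m' inner_add_right algebra_simps)
  have qD: "(norm (q + \<Delta>))\<^sup>2 = (norm q)\<^sup>2 + 2 * inner q \<Delta> + (norm \<Delta>)\<^sup>2"
    by (simp add: power2_norm_eq_inner inner_add_left inner_add_right inner_commute)
  have par: "(norm (q + m))\<^sup>2 = 2 * (norm q)\<^sup>2 + 2 * (norm m)\<^sup>2 - (norm (q - m))\<^sup>2"
    by (simp add: power2_norm_eq_inner inner_add_left inner_add_right inner_diff_left inner_diff_right inner_commute)
  have qqm: "inner q (q + m) = (norm q)\<^sup>2 + inner q m"
    by (simp add: power2_norm_eq_inner inner_add_right)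
  have f3: "(\<beta> + L * \<eta>\<^sup>2 / 2) * (2 * (1 - \<kappa>)\<^sup>2 * (\<eta> * L)\<^sup>2 * (norm p)\<^sup>2) \<le> 2 * X * l\<^sup>2 * (norm p)\<^sup>2"
  proof -
    have "(\<beta> + L * \<eta>\<^sup>2 / 2) * (2 * h\<^sup>2 * l\<^sup>2 * (norm p)\<^sup>2) \<le> (\<beta> + \<eta> * l) * (2 * h\<^sup>2 * l\<^sup>2 * (norm p)\<^sup>2)"
      using l by (intro mult_right_mono) (auto simp: l_def power2_eq_square)
    then show ?thesis by (simp add: X_def h_def l_def algebra_simps)
  qed
  have XQ: "X * Q * (norm \<Delta>)\<^sup>2 = X * (norm \<Delta>)\<^sup>2 + X * \<delta> * \<kappa> * (norm \<Delta>)\<^sup>2 + 2 * X * (l\<^sup>2 * R) * (norm \<Delta>)\<^sup>2"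
    unfolding Q \<delta>_def l_def by (simp add: algebra_simps)
  have XW: "X * W = X * \<delta> * \<kappa> * (norm \<Delta>)\<^sup>2 + X * (l\<^sup>2 * R) * (norm p)\<^sup>2 - 2 * X * l\<^sup>2 * (norm p)\<^sup>2 - X * (norm s)\<^sup>2"
    unfolding W_def by (simp add: algebra_simps)
  have t1: "\<eta> * (1 + \<kappa> - 2 * \<eta> * L) / 2 * (norm q)\<^sup>2 = \<eta> * (norm q)\<^sup>2 - \<eta> * h / 2 * (norm q)\<^sup>2 - \<eta> * l * (norm q)\<^sup>2"
    by (simp add: h_def l_def field_simps)
  have t2: "L * \<eta>\<^sup>2 / 2 * (norm (q + m))\<^sup>2 = \<eta> * l * (norm q)\<^sup>2 + \<eta> * l * (norm m)\<^sup>2 - \<eta> * l / 2 * (norm (q - m))\<^sup>2"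
    unfolding par by (simp add: l_def power2_eq_square field_simps)
  have t3: "\<eta> * inner q (q + m) = \<eta> * (norm q)\<^sup>2 + \<eta> * h * inner q \<Delta> + \<eta> * h * inner q s"
    unfolding qqm qm by (simp add: algebra_simps)
  have t4: "\<eta> * h / 2 * (norm (q + \<Delta>))\<^sup>2 = \<eta> * h / 2 * (norm q)\<^sup>2 + \<eta> * h * inner q \<Delta> + \<eta> * h / 2 * (norm \<Delta>)\<^sup>2"
    unfolding qD by (simp add: algebra_simps)
  have t5: "(\<beta> + \<eta> * l) * (norm m)\<^sup>2 = \<beta> * (norm m)\<^sup>2 + \<eta> * l * (norm m)\<^sup>2" by (simp add: algebra_simps)
  show ?thesis unfolding \<Delta>_def[symmetric]
    using key[unfolded t4 XW] f1[unfolded XQ] f2 f3 nm[unfolded t5] t1 t2 t3 by linarith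
qed

section \<open>Smooth functions\<close>

lemma smooth_upper_bound:
  fixes F :: "'a::real_inner \<Rightarrow> real"
  assumes grad: "\<And>x. GDERIV F x :> gF x"
    and lip: "\<And>x y. norm (gF x - gF y) \<le> L * norm (x - y)"
  shows "F (x + v) \<le> F x + inner (gF x) v + L / 2 * (norm v)\<^sup>2"
proof -
  \<comment> \<open>Subtracting the claimed quadratic upper bound along the segment leaves a
    function with nonpositive derivative, so the gradient need not be integrated.\<close>
  define \<phi> where "\<phi> t = F (x + t *\<^sub>R v) - t * inner (gF x) v - L / 2 * t\<^sup>2 * (norm v)\<^sup>2" for t
  have der: "(\<phi> has_real_derivative inner (gF (x + t *\<^sub>R v)) v - inner (gF x) v - L * t * (norm v)\<^sup>2) (at t)" for t
  proof -
    have "((\<lambda>t. F (x + t *\<^sub>R v)) has_derivative (\<lambda>s. inner (s *\<^sub>R v) (gF (x + t *\<^sub>R v)))) (at t)"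
      by (rule has_derivative_compose[of "\<lambda>t. x + t *\<^sub>R v" "\<lambda>s. s *\<^sub>R v"])
         (use grad in \<open>auto simp: gderiv_def intro!: derivative_eq_intros\<close>)
    then have "((\<lambda>t. F (x + t *\<^sub>R v)) has_real_derivative inner (gF (x + t *\<^sub>R v)) v) (at t)"
      unfolding has_field_derivative_def
      by (rule has_derivative_eq_rhs) (auto simp: inner_commute fun_eq_iff)
    then show ?thesis unfolding \<phi>_def
      by (auto intro!: derivative_eq_intros)
  qed
  have "\<phi> 1 \<le> \<phi> 0"
  proof (rule DERIV_nonpos_imp_nonincreasing[of 0 1])
    fix t :: real assume t: "0 \<le> t" "t \<le> 1"
    have "inner (gF (x + t *\<^sub>R v) - gF x) v \<le> norm (gF (x + t *\<^sub>R v) - gF x) * norm v"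
      by (rule norm_cauchy_schwarz)
    also have "\<dots> \<le> (L * (t * norm v)) * norm v"
      using lip[of "x + t *\<^sub>R v" x] t by (intro mult_right_mono) auto
    finally show "\<exists>y. (\<phi> has_real_derivative y) (at t) \<and> y \<le> 0"
      using der[of t] by (intro exI conjI) (auto simp: inner_diff_left power2_eq_square algebra_simps)
  qed simp
  then show ?thesis by (simp add: \<phi>_def)
qed

text \<open>A gradient step of length \<open>1 / L\<close> gains at least
  \<open>(norm (gF x))\<^sup>2 / (2 * L)\<close> and cannot get below the infimum. It serves for the
  last summand of the average, which no drift step covers.\<close>

lemma norm_gradient_sq_le_gap:
  fixes F :: "'a::real_inner \<Rightarrow> real"
  assumes grad: "\<And>x. GDERIV F x :> gF x"
    and lip: "\<And>x y. norm (gF x - gF y) \<le> L * norm (x - y)"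
    and bdd: "bdd_below (range F)" and L: "L > 0"
  shows "(norm (gF x))\<^sup>2 \<le> 2 * L * (F x - Inf (range F))"
proof -
  have "Inf (range F) \<le> F (x + (- (1 / L)) *\<^sub>R gF x)"
    using bdd by (intro cInf_lower) auto
  also have "\<dots> \<le> F x + inner (gF x) ((- (1 / L)) *\<^sub>R gF x) + L / 2 * (norm ((- (1 / L)) *\<^sub>R gF x))\<^sup>2"
    by (rule smooth_upper_bound[OF grad lip])
  also have "\<dots> = F x - (norm (gF x))\<^sup>2 / (2 * L)"
    using L by (simp add: power2_norm_eq_inner[symmetric] power_mult_distrib power_divide)
       (simp add: field_simps power2_eq_square)
  finally show ?thesis using L by (simp add: field_simps)
qed

section \<open>Moments of the noise\<close>

lemma expectation_uniform_lessThan: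
  fixes g :: "nat \<Rightarrow> 'b::euclidean_space"
  assumes "N > 0"
  shows "measure_pmf.expectation (pmf_of_set {..<N}) g = (1 / real N) *\<^sub>R (\<Sum>i<N. g i)"
proof -
  have "{..<N} \<noteq> {}" using assms by auto
  then show ?thesis
    by (subst integral_measure_pmf[of "{..<N}"]) (auto simp: scaleR_sum_right indicator_def intro!: sum.cong)
qed

lemma finite_set_minibatch_pmf: "N > 0 \<Longrightarrow> finite (set_pmf (Pi_pmf {..<B::nat} 0 (\<lambda>_. pmf_of_set {..<N::nat})))"
proof -
  assume "N > 0"
  then have "{..<N} \<noteq> {}" by auto
  then show ?thesis by (simp add: set_Pi_pmf finite_PiE_dflt)
qed

text \<open>Sampling is with replacement, so the \<open>B\<close> summands are independent and,
  being centred, uncorrelated. The induction splits one coordinate off the product; finite support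
  settles all integrability questions.\<close>

lemma minibatch_moments:
  fixes Z :: "nat \<Rightarrow> 'a::euclidean_space"
  assumes N: "N > 0" and Z: "(\<Sum>i<N. Z i) = 0"
  defines "p \<equiv> \<lambda>B. Pi_pmf {..<B::nat} 0 (\<lambda>_. pmf_of_set {..<N})"
  shows "measure_pmf.expectation (p B) (\<lambda>b. \<Sum>j<B. Z (b j)) = 0" (is "?mean B")
    and "measure_pmf.expectation (p B) (\<lambda>b. (norm (\<Sum>j<B. Z (b j)))\<^sup>2)
       = real B * ((\<Sum>i<N. (norm (Z i))\<^sup>2) / real N)" (is "?var B")
proof -
  let ?u = "pmf_of_set {..<N}"
  have p_Suc: "p (Suc B) = map_pmf (\<lambda>(y, f). f(B := y)) (pair_pmf ?u (p B))" for B
    unfolding p_def lessThan_Suc by (subst Pi_pmf_insert) auto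
  have fin: "finite (set_pmf (p B))" for B
    unfolding p_def by (rule finite_set_minibatch_pmf[OF N])
  have ne: "{..<N} \<noteq> {}" using N by auto
  then have fin2: "finite (set_pmf ?u)" by simp
  have pu: "pmf ?u y = 1 / real N" if "y < N" for y
    using that pmf_of_set[OF ne] by (simp add: indicator_def)
  have upd: "(\<Sum>j<B. Z ((f(B := y)) j)) = (\<Sum>j<B. Z (f j))" for B y and f :: "nat \<Rightarrow> nat"
    by (intro sum.cong) auto
  have step: "measure_pmf.expectation (p (Suc B)) (\<lambda>b. g (\<Sum>j<Suc B. Z (b j)))
     = measure_pmf.expectation (pair_pmf ?u (p B)) (\<lambda>(y, f). g ((\<Sum>j<B. Z (f j)) + Z y))"
    for B and g :: "'a \<Rightarrow> 'c::euclidean_space"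
    unfolding p_Suc integral_map_pmf
    by (intro Bochner_Integration.integral_cong) (auto simp: upd)
  have int: "integrable (measure_pmf (pair_pmf ?u (p B))) g" for B and g :: "_ \<Rightarrow> 'c::euclidean_space"
    by (intro integrable_measure_pmf_finite) (use fin fin2 in auto)
  have int2: "integrable (measure_pmf (p B)) g" for B and g :: "_ \<Rightarrow> 'c::euclidean_space"
    by (intro integrable_measure_pmf_finite fin)
  have fstE: "measure_pmf.expectation (pair_pmf ?u (p B)) (\<lambda>x. g (fst x)) = measure_pmf.expectation ?u g"
    for B and g :: "_ \<Rightarrow> 'c::euclidean_space"
    using integral_map_pmf[of fst "pair_pmf ?u (p B)" g] by (simp add: map_fst_pair_pmf)
  have sndE: "measure_pmf.expectation (pair_pmf ?u (p B)) (\<lambda>x. g (snd x)) = measure_pmf.expectation (p B) g"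
    for B and g :: "_ \<Rightarrow> 'c::euclidean_space"
    using integral_map_pmf[of snd "pair_pmf ?u (p B)" g] by (simp add: map_snd_pair_pmf)
  have uZ: "measure_pmf.expectation ?u Z = 0"
    by (simp add: expectation_uniform_lessThan[OF N] Z)
  show "?mean B"
  proof (induction B)
    case 0 then show ?case by simp
  next
    case (Suc B)
    have "measure_pmf.expectation (p (Suc B)) (\<lambda>b. \<Sum>j<Suc B. Z (b j))
      = measure_pmf.expectation (pair_pmf ?u (p B)) (\<lambda>x. (\<Sum>j<B. Z (snd x j)) + Z (fst x))"
      unfolding step[of B "\<lambda>x. x"] by (simp only: case_prod_unfold)
    also have "\<dots> = measure_pmf.expectation (p B) (\<lambda>f. \<Sum>j<B. Z (f j)) + measure_pmf.expectation ?u Z"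
      unfolding fstE[of B Z, symmetric] sndE[of B "\<lambda>f. \<Sum>j<B. Z (f j)", symmetric]
      by (intro Bochner_Integration.integral_add int)
    finally show ?case using Suc uZ by simp
  qed
  show "?var B"
  proof (induction B)
    case 0 then show ?case by simp
  next
    case (Suc B)
    \<comment> \<open>With the other samples fixed, summing over the new index leaves an inner
      product with \<open>\<Sum>y<N. Z y\<close>, which is 0.\<close>
    have cross: "measure_pmf.expectation (pair_pmf ?u (p B)) (\<lambda>x. inner (\<Sum>j<B. Z (snd x j)) (Z (fst x))) = 0"
      (is "?E = 0")
    proof -
      have "?E = (\<Sum>x\<in>{..<N} \<times> set_pmf (p B). pmf (pair_pmf ?u (p B)) x * inner (\<Sum>j<B. Z (snd x j)) (Z (fst x)))"
        using fin ne by (subst integral_measure_pmf[of "{..<N} \<times> set_pmf (p B)"]) auto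
      also have "\<dots> = (\<Sum>y<N. \<Sum>f\<in>set_pmf (p B). inner ((pmf (p B) f / real N) *\<^sub>R (\<Sum>j<B. Z (f j))) (Z y))"
        by (auto simp: sum.cartesian_product pmf_pair pu intro!: sum.cong)
      also have "\<dots> = (\<Sum>f\<in>set_pmf (p B). inner ((pmf (p B) f / real N) *\<^sub>R (\<Sum>j<B. Z (f j))) (\<Sum>y<N. Z y))"
        by (subst sum.swap) (simp add: inner_sum_right)
      finally show ?thesis by (simp add: Z)
    qed
    have uv: "measure_pmf.expectation ?u (\<lambda>i. (norm (Z i))\<^sup>2) = (\<Sum>i<N. (norm (Z i))\<^sup>2) / real N"
      by (simp add: expectation_uniform_lessThan[OF N])
    have "measure_pmf.expectation (p (Suc B)) (\<lambda>b. (norm (\<Sum>j<Suc B. Z (b j)))\<^sup>2)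
      = measure_pmf.expectation (pair_pmf ?u (p B)) (\<lambda>x. (norm (\<Sum>j<B. Z (snd x j)))\<^sup>2
           + 2 * inner (\<Sum>j<B. Z (snd x j)) (Z (fst x)) + (norm (Z (fst x)))\<^sup>2)"
      unfolding step[of B "\<lambda>x. (norm x)\<^sup>2"]
      by (intro Bochner_Integration.integral_cong)
         (auto simp: power2_norm_eq_inner inner_add_left inner_add_right inner_commute)
    also have "\<dots> = measure_pmf.expectation (p B) (\<lambda>f. (norm (\<Sum>j<B. Z (f j)))\<^sup>2)
        + 2 * 0 + measure_pmf.expectation ?u (\<lambda>i. (norm (Z i))\<^sup>2)"
      using cross fstE[of B "\<lambda>i. (norm (Z i))\<^sup>2"] sndE[of B "\<lambda>f. (norm (\<Sum>j<B. Z (f j)))\<^sup>2"]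
      by (simp add: int)
    finally show ?case unfolding Suc uv by (simp add: algebra_simps add_divide_distrib)
  qed
qed

section \<open>The Gaussian vector and the combined noise of one step\<close>

lemma gauss_vec_zero: "gauss_vec 0 = return borel 0"
  by (simp add: gauss_vec_def)

lemma sets_gauss_vec [measurable_cong, simp]: "sets (gauss_vec \<sigma>) = sets borel"
  by (simp add: gauss_vec_def)

lemma prod_Basis_vec:
  fixes \<phi> :: "real ^ 'd \<Rightarrow> 'c::comm_monoid_mult"
  shows "(\<Prod>b\<in>Basis. \<phi> b) = (\<Prod>i\<in>UNIV. \<phi> (axis i 1))"
proof -
  have "(Basis :: (real ^ 'd) set) = range (\<lambda>i. axis i 1)" by (auto simp: Basis_vec_def)
  moreover have "inj (\<lambda>i. axis i (1::real) :: real ^ 'd)" by (simp add: inj_on_def axis_eq_axis)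
  ultimately show ?thesis by (metis (mono_tags, lifting) prod.reindex_cong)
qed

lemma nn_integral_lborel_vec_prod:
  fixes f :: "'d::finite \<Rightarrow> real \<Rightarrow> real"
  assumes [measurable]: "\<And>i. f i \<in> borel_measurable borel" and nn: "\<And>i x. 0 \<le> f i x"
  shows "(\<integral>\<^sup>+x. ennreal (\<Prod>i\<in>UNIV. f i ((x :: real ^ 'd) $ i)) \<partial>lborel) = (\<Prod>i\<in>UNIV. (\<integral>\<^sup>+x. ennreal (f i x) \<partial>lborel))"
proof -
  define g where "g b = f (the_inv (\<lambda>i. axis i (1::real)) b)" for b :: "real ^ 'd"
  have inj: "inj (\<lambda>i. axis i (1::real) :: real ^ 'd)" by (simp add: inj_on_def axis_eq_axis)
  have g: "g (axis i 1) = f i" for i by (simp add: g_def the_inv_f_f[OF inj])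
  have "(\<integral>\<^sup>+x. (\<Prod>b\<in>Basis. ennreal (g b ((x :: real ^ 'd) \<bullet> b))) \<partial>lborel) = (\<Prod>b\<in>Basis. (\<integral>\<^sup>+x. ennreal (g b x) \<partial>lborel))"
    by (intro nn_integral_lborel_prod) (auto simp: Basis_vec_def g nn)
  then show ?thesis
    by (simp add: prod_Basis_vec g inner_axis prod_ennreal nn)
qed

lemma prob_space_gauss_vec:
  assumes "\<sigma> \<ge> 0"
  shows "prob_space (gauss_vec \<sigma> :: (real ^ 'd) measure)"
proof (cases "\<sigma> = 0")
  case True then show ?thesis by (simp add: gauss_vec_zero prob_space_return)
next
  case False
  with assms have \<sigma>: "\<sigma> > 0" by simp
  have nd: "(\<integral>\<^sup>+x. ennreal (normal_density 0 \<sigma> x) \<partial>lborel) = 1"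
    using \<sigma> by (subst nn_integral_eq_integral) auto
  have "(\<integral>\<^sup>+w. ennreal (\<Prod>i\<in>UNIV. normal_density 0 \<sigma> ((w :: real ^ 'd) $ i)) \<partial>lborel) = 1"
    by (subst nn_integral_lborel_vec_prod) (auto simp: nd)
  then show ?thesis using False
    by (intro prob_spaceI) (simp add: gauss_vec_def emeasure_density)
qed

lemma gauss_vec_component_sq:
  assumes \<sigma>: "\<sigma> > 0"
  shows "(\<integral>\<^sup>+w. ennreal ((w $ k)\<^sup>2) \<partial>(gauss_vec \<sigma> :: (real ^ 'd) measure)) = ennreal (\<sigma>\<^sup>2)"
proof -
  let ?n = "normal_density 0 \<sigma>"
  have nd: "(\<integral>\<^sup>+x. ennreal (?n x) \<partial>lborel) = 1"
    using \<sigma> by (subst nn_integral_eq_integral) auto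
  have n2: "(\<integral>\<^sup>+x. ennreal (?n x * x\<^sup>2) \<partial>lborel) = ennreal (\<sigma>\<^sup>2)"
    using normal_moment_even[OF \<sigma>, of 0 1] integrable_normal_moment[OF \<sigma>, of 0 2] integral_normal_moment_even[OF \<sigma>, of 0 1]
    by (subst nn_integral_eq_integral) auto
  define f where "f i x = (if i = k then ?n x * x\<^sup>2 else ?n x)" for i and x :: real
  have [measurable]: "\<And>i. f i \<in> borel_measurable borel" by (auto simp: f_def[abs_def])
  have "(\<Prod>i\<in>UNIV. ?n (w $ i)) * (w $ k)\<^sup>2 = (\<Prod>i\<in>UNIV. f i (w $ i))" for w :: "real ^ 'd"
  proof -
    have "(\<Prod>i\<in>UNIV. f i (w $ i)) = f k (w $ k) * (\<Prod>i\<in>UNIV - {k}. f i (w $ i))"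
      by (rule prod.remove) auto
    also have "(\<Prod>i\<in>UNIV - {k}. f i (w $ i)) = (\<Prod>i\<in>UNIV - {k}. ?n (w $ i))"
      by (intro prod.cong) (auto simp: f_def)
    also have "f k (w $ k) * (\<Prod>i\<in>UNIV - {k}. ?n (w $ i)) = (?n (w $ k) * (\<Prod>i\<in>UNIV - {k}. ?n (w $ i))) * (w $ k)\<^sup>2"
      by (simp add: f_def)
    also have "?n (w $ k) * (\<Prod>i\<in>UNIV - {k}. ?n (w $ i)) = (\<Prod>i\<in>UNIV. ?n (w $ i))"
      by (rule prod.remove[symmetric]) auto
    finally show ?thesis by simp
  qed
  then have "(\<integral>\<^sup>+w. ennreal ((w $ k)\<^sup>2) \<partial>(gauss_vec \<sigma> :: (real ^ 'd) measure))
     = (\<integral>\<^sup>+w. ennreal (\<Prod>i\<in>UNIV. f i ((w :: real ^ 'd) $ i)) \<partial>lborel)"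
    using \<sigma> by (simp add: gauss_vec_def nn_integral_density prod_nonneg flip: ennreal_mult')
  also have "\<dots> = (\<Prod>i\<in>UNIV. (\<integral>\<^sup>+x. ennreal (f i x) \<partial>lborel))"
    by (rule nn_integral_lborel_vec_prod) (auto simp: f_def)
  also have "\<dots> = (\<Prod>i\<in>UNIV. if i = k then ennreal (\<sigma>\<^sup>2) else 1)"
    by (intro prod.cong) (auto simp: f_def nd n2)
  finally show ?thesis by simp
qed

lemma gauss_vec_second_moment:
  assumes "\<sigma> \<ge> 0"
  shows "integrable (gauss_vec \<sigma>) (\<lambda>w :: real ^ 'd. (norm w)\<^sup>2)"
    and "(\<integral>w. (norm w)\<^sup>2 \<partial>(gauss_vec \<sigma> :: (real ^ 'd) measure)) = real CARD('d) * \<sigma>\<^sup>2"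
proof -
  have eq: "(\<integral>\<^sup>+w. ennreal ((norm w)\<^sup>2) \<partial>(gauss_vec \<sigma> :: (real ^ 'd) measure)) = ennreal (real CARD('d) * \<sigma>\<^sup>2)"
  proof (cases "\<sigma> = 0")
    case True then show ?thesis by (simp add: gauss_vec_zero nn_integral_return)
  next
    case False
    with assms have \<sigma>: "\<sigma> > 0" by simp
    have "(norm w)\<^sup>2 = (\<Sum>i\<in>UNIV. (w $ i)\<^sup>2)" for w :: "real ^ 'd"
      by (simp add: norm_vec_def L2_set_def sum_nonneg)
    then have "(\<integral>\<^sup>+w. ennreal ((norm w)\<^sup>2) \<partial>(gauss_vec \<sigma> :: (real ^ 'd) measure))
        = (\<Sum>i\<in>(UNIV :: 'd set). \<integral>\<^sup>+w. ennreal ((w $ i)\<^sup>2) \<partial>(gauss_vec \<sigma> :: (real ^ 'd) measure))"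
      by (simp add: nn_integral_sum flip: sum_ennreal)
    then show ?thesis
      using gauss_vec_component_sq[OF \<sigma>, where 'd = 'd]
      by (simp add: ennreal_mult ennreal_of_nat_eq_real_of_nat)
  qed
  show "integrable (gauss_vec \<sigma>) (\<lambda>w :: real ^ 'd. (norm w)\<^sup>2)"
    by (rule integrableI_nn_integral_finite[OF _ _ eq]) auto
  show "(\<integral>w. (norm w)\<^sup>2 \<partial>(gauss_vec \<sigma> :: (real ^ 'd) measure)) = real CARD('d) * \<sigma>\<^sup>2"
    by (rule integral_eq_nn_integral[THEN trans]) (auto simp: eq)
qed

text \<open>The density is even and \<open>inner v\<close> is odd, so reflecting Lebesgue measure
  turns the mean into its own negative. Integrability comes from the second moment.\<close>

lemma gauss_vec_mean:
  fixes v :: "real ^ 'd"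
  assumes "\<sigma> \<ge> 0"
  shows "integrable (gauss_vec \<sigma>) (\<lambda>w. inner v w)" and "(\<integral>w. inner v w \<partial>gauss_vec \<sigma>) = 0"
proof -
  interpret prob_space "gauss_vec \<sigma> :: (real ^ 'd) measure" by (rule prob_space_gauss_vec[OF assms])
  show "integrable (gauss_vec \<sigma>) (\<lambda>w. inner v w)"
  proof (rule Bochner_Integration.integrable_bound)
    show "integrable (gauss_vec \<sigma>) (\<lambda>w :: real ^ 'd. (norm v)\<^sup>2 + (norm w)\<^sup>2)"
      using gauss_vec_second_moment(1)[OF assms] by auto
    have "\<bar>inner v w\<bar> \<le> (norm v)\<^sup>2 + (norm w)\<^sup>2" for w
      using Cauchy_Schwarz_ineq2[of v w] sum_squares_bound[of "norm v" "norm w"]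
        mult_nonneg_nonneg[of "norm v" "norm w"] by (simp add: power2_eq_square)
    then show "AE w in gauss_vec \<sigma>. norm (inner v w) \<le> norm ((norm v)\<^sup>2 + (norm w)\<^sup>2)"
      by simp
  qed simp
  show "(\<integral>w. inner v w \<partial>gauss_vec \<sigma>) = 0"
  proof (cases "\<sigma> = 0")
    case True then show ?thesis by (simp add: gauss_vec_zero integral_return)
  next
    case False
    let ?n = "\<lambda>w :: real ^ 'd. \<Prod>i\<in>UNIV. normal_density 0 \<sigma> (w $ i)"
    have "(\<integral>w. inner v w \<partial>gauss_vec \<sigma>) = (\<integral>w. ?n w * inner v w \<partial>lborel)"
      using False by (simp add: gauss_vec_def integral_density prod_nonneg)
    also have "\<dots> = (\<integral>w. ?n (- w) * inner v (- w) \<partial>lborel)"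
    proof -
      have "(lborel :: (real ^ 'd) measure) = distr lborel borel uminus"
        using lborel_affine[of "-1::real" "0 :: real ^ 'd"] by (simp add: density_1 uminus_add_conv_diff)
      then show ?thesis by (subst integral_distr[of uminus lborel borel, symmetric]) simp_all
    qed
    also have "\<dots> = - (\<integral>w. ?n w * inner v w \<partial>lborel)"
      by (simp add: normal_density_def)
    finally show ?thesis using False by (simp add: gauss_vec_def integral_density prod_nonneg)
  qed
qed

text \<open>A quadratic polynomial in centred noise: the linear part integrates to 0 and the square
  to the two variances. Nonnegativity of the polynomial allows Fubini in \<open>ennreal\<close> and
  also gives \<open>0 \<le> m\<close>, needed to convert sums of \<open>ennreal\<close> values back
  to reals.\<close>

lemma nn_integral_minibatch_gauss:
  fixes Z :: "nat \<Rightarrow> real ^ 'd" and \<kappa> :: real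
  assumes N: "N > 0" and B: "B > 0" and \<sigma>: "\<sigma> \<ge> 0" and Z: "(\<Sum>i<N. Z i) = 0"
  defines "n \<equiv> \<lambda>\<xi>. (1 / real B) *\<^sub>R (\<Sum>j<B. Z (fst \<xi> j)) + \<kappa> *\<^sub>R snd \<xi>"
  assumes nonneg: "\<And>\<xi>. 0 \<le> a + inner v (n \<xi>) + c * (norm (n \<xi>))\<^sup>2"
  defines "m \<equiv> a + c * ((\<Sum>i<N. (norm (Z i))\<^sup>2) / real N / real B + \<kappa>\<^sup>2 * (real CARD('d) * \<sigma>\<^sup>2))"
  shows "(\<integral>\<^sup>+\<xi>. ennreal (a + inner v (n \<xi>) + c * (norm (n \<xi>))\<^sup>2) \<partial>(batch_measure N B \<Otimes>\<^sub>M gauss_vec \<sigma>)) = ennreal m"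
    and "0 \<le> m"
proof -
  interpret G: prob_space "gauss_vec \<sigma> :: (real ^ 'd) measure" by (rule prob_space_gauss_vec[OF \<sigma>])
  let ?p = "Pi_pmf {..<B} 0 (\<lambda>_. pmf_of_set {..<N})"
  let ?d = "real CARD('d) * \<sigma>\<^sup>2"
  define n1 where "n1 b = (1 / real B) *\<^sub>R (\<Sum>j<B. Z (b j))" for b :: "nat \<Rightarrow> nat"
  define A where "A b = a + inner v (n1 b) + c * (norm (n1 b))\<^sup>2" for b
  have n: "n \<xi> = n1 (fst \<xi>) + \<kappa> *\<^sub>R snd \<xi>" for \<xi> by (simp add: n_def n1_def)
  have inner_int: "(\<integral>\<^sup>+w. ennreal (a + inner v (n (b, w)) + c * (norm (n (b, w)))\<^sup>2) \<partial>gauss_vec \<sigma>) = ennreal (A b + c * \<kappa>\<^sup>2 * ?d)"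
    and nn1: "0 \<le> A b + c * \<kappa>\<^sup>2 * ?d" for b
  proof -
    \<comment> \<open>Everything linear in the Gaussian part for a fixed batch, including the cross
      term of the square.\<close>
    define u where "u = \<kappa> *\<^sub>R v + (2 * c * \<kappa>) *\<^sub>R n1 b"
    have eq: "a + inner v (n (b, w)) + c * (norm (n (b, w)))\<^sup>2 = A b + inner u w + c * \<kappa>\<^sup>2 * (norm w)\<^sup>2" for w
      unfolding n A_def u_def power2_norm_eq_inner
      by (simp add: inner_add_left inner_add_right inner_commute power2_eq_square algebra_simps)
    note int = gauss_vec_second_moment(1)[OF \<sigma>, where 'd = 'd] gauss_vec_mean(1)[OF \<sigma>, of u]
    have "integrable (gauss_vec \<sigma>) (\<lambda>w. A b + inner u w + c * \<kappa>\<^sup>2 * (norm w)\<^sup>2)"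
      using int by auto
    moreover have I: "(\<integral>w. A b + inner u w + c * \<kappa>\<^sup>2 * (norm w)\<^sup>2 \<partial>gauss_vec \<sigma>) = A b + c * \<kappa>\<^sup>2 * ?d"
      using int gauss_vec_second_moment(2)[OF \<sigma>, where 'd = 'd] gauss_vec_mean(2)[OF \<sigma>, of u]
      by (simp add: G.prob_space)
    moreover have nn: "0 \<le> A b + inner u w + c * \<kappa>\<^sup>2 * (norm w)\<^sup>2" for w
      using nonneg[of "(b, w)"] unfolding eq .
    ultimately show "(\<integral>\<^sup>+w. ennreal (a + inner v (n (b, w)) + c * (norm (n (b, w)))\<^sup>2) \<partial>gauss_vec \<sigma>) = ennreal (A b + c * \<kappa>\<^sup>2 * ?d)"
      unfolding eq by (subst nn_integral_eq_integral) auto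
    show "0 \<le> A b + c * \<kappa>\<^sup>2 * ?d" using nn unfolding I[symmetric] by (intro Bochner_Integration.integral_nonneg)
  qed
  have fin: "finite (set_pmf ?p)" by (rule finite_set_minibatch_pmf[OF N])
  have int: "integrable (measure_pmf ?p) g" for g :: "_ \<Rightarrow> 'b::euclidean_space"
    by (intro integrable_measure_pmf_finite fin)
  have [measurable]: "n1 \<in> borel_measurable (measure_pmf ?p)" by simp
  have "(\<lambda>\<xi>. ennreal (a + inner v (n \<xi>) + c * (norm (n \<xi>))\<^sup>2)) \<in> borel_measurable (measure_pmf ?p \<Otimes>\<^sub>M gauss_vec \<sigma>)"
    unfolding n by measurable
  note fubini = G.nn_integral_fst[OF this]
  have mean0: "measure_pmf.expectation ?p n1 = 0"
    using minibatch_moments(1)[OF N Z, of B] by (simp add: n1_def[abs_def] integral_scaleR_right int)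
  have var: "measure_pmf.expectation ?p (\<lambda>b. (norm (n1 b))\<^sup>2) = (\<Sum>i<N. (norm (Z i))\<^sup>2) / real N / real B"
    using minibatch_moments(2)[OF N Z, of B] B
    by (simp add: n1_def[abs_def] power_mult_distrib power_divide) (simp add: field_simps power2_eq_square)
  have m: "measure_pmf.expectation ?p (\<lambda>b. A b + c * \<kappa>\<^sup>2 * ?d) = m"
  proof -
    have "measure_pmf.expectation ?p (\<lambda>b. A b + c * \<kappa>\<^sup>2 * ?d)
      = a + inner v (measure_pmf.expectation ?p n1) + c * measure_pmf.expectation ?p (\<lambda>b. (norm (n1 b))\<^sup>2) + c * \<kappa>\<^sup>2 * ?d"
      unfolding A_def by (simp add: int)
    then show ?thesis unfolding mean0 var by (simp add: m_def algebra_simps)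
  qed
  show "0 \<le> m" unfolding m[symmetric] using nn1 by (intro Bochner_Integration.integral_nonneg)
  have "(\<integral>\<^sup>+b. ennreal (A b + c * \<kappa>\<^sup>2 * ?d) \<partial>measure_pmf ?p) = ennreal m"
    unfolding m[symmetric] using nn1 by (intro nn_integral_eq_integral int) auto
  then show "(\<integral>\<^sup>+\<xi>. ennreal (a + inner v (n \<xi>) + c * (norm (n \<xi>))\<^sup>2) \<partial>(batch_measure N B \<Otimes>\<^sub>M gauss_vec \<sigma>)) = ennreal m"
    using fubini unfolding batch_measure_def inner_int by simp
qed

section \<open>Drift bounds for iterated random maps\<close>

lemma measurable_iterated_step:
  assumes S0: "\<And>w. S w 0 = init" and SS: "\<And>w t. S w (Suc t) = step (S w t) (w t)"
    and step: "(\<lambda>(s, \<xi>). step s \<xi>) \<in> N \<Otimes>\<^sub>M M \<rightarrow>\<^sub>M N" and init: "init \<in> space N"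
  shows "t \<le> T \<Longrightarrow> (\<lambda>w. S w t) \<in> PiM {..<T} (\<lambda>_. M) \<rightarrow>\<^sub>M N"
proof (induction t)
  case 0
  then show ?case using init by (simp add: S0)
next
  case (Suc t)
  then have [measurable]: "(\<lambda>w. S w t) \<in> PiM {..<T} (\<lambda>_. M) \<rightarrow>\<^sub>M N" by simp
  have [measurable]: "(\<lambda>w. w t) \<in> PiM {..<T} (\<lambda>_. M) \<rightarrow>\<^sub>M M"
    using Suc by (intro measurable_component_singleton) auto
  have "(\<lambda>w. (\<lambda>(s, \<xi>). step s \<xi>) (S w t, w t)) \<in> PiM {..<T} (\<lambda>_. M) \<rightarrow>\<^sub>M N"
    by (rule measurable_compose[OF _ step]) measurable
  then show ?case by (simp add: SS)
qed

text \<open>Integrating the newest coordinate first, with the earlier ones fixed, plays the role of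
  conditional expectation, and the one-step inequalities telescope. With values in
  \<open>ennreal\<close> no integrability of \<open>U\<close> is required. \<open>I\<close> is a
  pathwise invariant to which the drift hypothesis may be restricted.\<close>

lemma iterated_step_drift_bound:
  fixes S :: "(nat \<Rightarrow> 'a) \<Rightarrow> nat \<Rightarrow> 's" and U c :: "'s \<Rightarrow> ennreal"
  assumes M: "prob_space M"
    and S0: "\<And>w. S w 0 = init" and SS: "\<And>w t. S w (Suc t) = step (S w t) (w t)"
    and step: "(\<lambda>(s, \<xi>). step s \<xi>) \<in> N \<Otimes>\<^sub>M M \<rightarrow>\<^sub>M N" and init: "init \<in> space N"
    and U [measurable]: "U \<in> borel_measurable N" and c [measurable]: "c \<in> borel_measurable N"
    and inv: "I init" "\<And>s \<xi>. I s \<Longrightarrow> I (step s \<xi>)"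
    and drift: "\<And>s. s \<in> space N \<Longrightarrow> I s \<Longrightarrow> (\<integral>\<^sup>+\<xi>. U (step s \<xi>) \<partial>M) + c s \<le> U s + K"
  shows "(\<integral>\<^sup>+w. U (S w T) + (\<Sum>t<T. c (S w t)) \<partial>PiM {..<T} (\<lambda>_. M)) \<le> U init + of_nat T * K"
proof (induction T)
  case 0
  have "emeasure (PiM {} (\<lambda>_::nat. M)) (space (PiM {} (\<lambda>_. M))) = 1"
    by (intro prob_space.emeasure_space_1 prob_space_PiM M)
  then show ?case by (simp add: S0)
next
  case (Suc T)
  interpret M: prob_space M by (rule M)
  interpret product_sigma_finite "\<lambda>_::nat. M" by standard
  interpret P: prob_space "PiM {..<T} (\<lambda>_. M)" by (intro prob_space_PiM M)
  note meas = measurable_iterated_step[OF S0 SS step init]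
  have [measurable]: "(\<lambda>w. S w t) \<in> PiM {..<Suc T} (\<lambda>_. M) \<rightarrow>\<^sub>M N" if "t \<le> Suc T" for t
    using that by (rule meas)
  have mT: "(\<lambda>w. S w t) \<in> PiM {..<T} (\<lambda>_. M) \<rightarrow>\<^sub>M N" if "t \<le> T" for t
    using that by (rule meas)
  \<comment> \<open>The states up to time \<open>T\<close> read only coordinates below
    \<open>T\<close>, hence are constants for the integration over coordinate
    \<open>T\<close>.\<close>
  have upd: "S (w(T := y)) t = S w t" if "t \<le> T" for t y and w :: "nat \<Rightarrow> 'a"
    using that by (induction t) (auto simp: S0 SS)
  have I: "I (S w t)" for w t by (induction t) (auto simp: S0 SS inv)
  let ?f = "\<lambda>w. U (S w (Suc T)) + (\<Sum>t<Suc T. c (S w t))"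
  have "(\<lambda>w. c (S w t)) \<in> borel_measurable (PiM {..<Suc T} (\<lambda>_. M))" if "t < Suc T" for t
    using that by (intro measurable_compose[OF _ c] meas) simp
  then have f: "?f \<in> borel_measurable (PiM {..<Suc T} (\<lambda>_. M))" by measurable
  have "(\<integral>\<^sup>+w. ?f w \<partial>PiM {..<Suc T} (\<lambda>_. M))
      = (\<integral>\<^sup>+w. \<integral>\<^sup>+y. ?f (w(T := y)) \<partial>M \<partial>PiM {..<T} (\<lambda>_. M))"
    using f unfolding lessThan_Suc by (intro product_nn_integral_insert) auto
  also have "\<dots> \<le> (\<integral>\<^sup>+w. (U (S w T) + (\<Sum>t<T. c (S w t))) + K \<partial>PiM {..<T} (\<lambda>_. M))"
  proof (rule nn_integral_mono)
    fix w assume "w \<in> space (PiM {..<T} (\<lambda>_. M))"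
    then have sp: "S w T \<in> space N" using measurable_space[OF mT[of T]] by simp
    have "(\<lambda>\<xi>. (\<lambda>(s, \<xi>). step s \<xi>) (S w T, \<xi>)) \<in> M \<rightarrow>\<^sub>M N"
      by (rule measurable_compose[OF measurable_Pair1'[OF sp] step])
    then have [measurable]: "step (S w T) \<in> M \<rightarrow>\<^sub>M N" by simp
    have "(\<integral>\<^sup>+y. ?f (w(T := y)) \<partial>M) = (\<integral>\<^sup>+y. U (step (S w T) y) + (c (S w T) + (\<Sum>t<T. c (S w t))) \<partial>M)"
      by (intro nn_integral_cong) (simp add: SS upd add_ac)
    also have "\<dots> = (\<integral>\<^sup>+y. U (step (S w T) y) \<partial>M) + (c (S w T) + (\<Sum>t<T. c (S w t)))"
      by (subst nn_integral_add) (auto simp: M.emeasure_space_1)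
    also have "\<dots> \<le> (U (S w T) + K) + (\<Sum>t<T. c (S w t))"
      unfolding add.assoc[symmetric] by (rule add_right_mono[OF drift[OF sp I]])
    finally show "(\<integral>\<^sup>+y. ?f (w(T := y)) \<partial>M) \<le> (U (S w T) + (\<Sum>t<T. c (S w t))) + K"
      by (simp add: add_ac)
  qed
  also have "\<dots> = (\<integral>\<^sup>+w. U (S w T) + (\<Sum>t<T. c (S w t)) \<partial>PiM {..<T} (\<lambda>_. M)) + K"
  proof (subst nn_integral_add)
    have "(\<lambda>w. c (S w t)) \<in> borel_measurable (PiM {..<T} (\<lambda>_. M))" if "t < T" for t
      using measurable_compose[OF mT c] that by simp
    then show "(\<lambda>w. U (S w T) + (\<Sum>t<T. c (S w t))) \<in> borel_measurable (PiM {..<T} (\<lambda>_. M))"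
      using measurable_compose[OF mT[of T] U] by measurable
  qed (auto simp: P.emeasure_space_1)
  also have "\<dots> \<le> (U init + of_nat T * K) + K" using Suc by (rule add_right_mono)
  also have "\<dots> = U init + of_nat (Suc T) * K" by (simp add: algebra_simps)
  finally show ?case .
qed

section \<open>The DiSK iteration\<close>

lemma borel_measurable_clip [measurable]:
  fixes f :: "'b \<Rightarrow> 'a::euclidean_space"
  assumes [measurable]: "f \<in> borel_measurable M"
  shows "(\<lambda>x. clip (f x) C) \<in> borel_measurable M"
  unfolding clip_def by measurable

text \<open>The body of the recursion as a map of the state and a single draw, the shape that the
  drift lemma expects.\<close>

definition disk_step ::
  "(nat \<Rightarrow> 'a::real_normed_vector \<Rightarrow> 'a) \<Rightarrow> nat \<Rightarrow> real \<Rightarrow> real \<Rightarrow> real \<Rightarrow> real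
    \<Rightarrow> 'a \<times> 'a \<times> 'a \<Rightarrow> (nat \<Rightarrow> nat) \<times> 'a \<Rightarrow> 'a \<times> 'a \<times> 'a" where
  "disk_step gf B \<eta> \<gamma> \<kappa> C s \<xi> =
     (let x = fst s; dp = fst (snd s); gp = snd (snd s);
          a = (1 - \<kappa>) / (\<kappa> * \<gamma>);
          g = (1 / real B) *\<^sub>R (\<Sum>j<B. clip (a *\<^sub>R gf (fst \<xi> j) (x + \<gamma> *\<^sub>R dp) + (1 - a) *\<^sub>R gf (fst \<xi> j) x) C) + snd \<xi>;
          gt = (1 - \<kappa>) *\<^sub>R gp + \<kappa> *\<^sub>R g;
          xn = x - \<eta> *\<^sub>R gt
      in (xn, xn - x, gt))"

lemma disk_state_Suc_step:
  "disk_state gf B x0 \<eta> \<gamma> \<kappa> C \<omega> (Suc t) = disk_step gf B \<eta> \<gamma> \<kappa> C (disk_state gf B x0 \<eta> \<gamma> \<kappa> C \<omega> t) (\<omega> t)"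
  by (simp add: disk_step_def Let_def split: prod.split)

lemma measurable_disk_step:
  fixes gf :: "nat \<Rightarrow> real ^ 'd \<Rightarrow> real ^ 'd"
  assumes gf: "\<And>i. gf i \<in> borel_measurable borel"
  shows "(\<lambda>(s, \<xi>). disk_step gf B \<eta> \<gamma> \<kappa> C s \<xi>)
    \<in> (borel \<Otimes>\<^sub>M borel \<Otimes>\<^sub>M borel) \<Otimes>\<^sub>M (batch_measure N B \<Otimes>\<^sub>M gauss_vec \<sigma>)
    \<rightarrow>\<^sub>M borel \<Otimes>\<^sub>M borel \<Otimes>\<^sub>M borel"
proof -
  let ?M = "(borel \<Otimes>\<^sub>M borel \<Otimes>\<^sub>M borel) \<Otimes>\<^sub>M (batch_measure N B \<Otimes>\<^sub>M gauss_vec \<sigma>)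
    :: (((real^'d) \<times> (real^'d) \<times> (real^'d)) \<times> (nat \<Rightarrow> nat) \<times> (real ^ 'd)) measure"
  have idx [measurable]: "(\<lambda>z. fst (snd z) j) \<in> ?M \<rightarrow>\<^sub>M count_space UNIV" for j
  proof (rule measurable_compose[of "\<lambda>z. fst (snd z)" _ "batch_measure N B"])
    show "(\<lambda>b. b j) \<in> batch_measure N B \<rightarrow>\<^sub>M count_space UNIV" by (simp add: batch_measure_def)
  qed measurable
  \<comment> \<open>The index of the gradient is random. It has countably many values, so
    measurability of each single \<open>gf i\<close> suffices.\<close>
  have g [measurable]: "(\<lambda>z. gf (fst (snd z) j) (h z)) \<in> borel_measurable ?M"
    if [measurable]: "h \<in> borel_measurable ?M" for h j
    by (rule measurable_compose_countable[OF _ idx]) (rule measurable_compose[OF _ gf], measurable)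
  have [measurable]: "(\<lambda>z. snd (snd z)) \<in> borel_measurable ?M"
    by (rule measurable_compose[of _ _ "batch_measure N B \<Otimes>\<^sub>M gauss_vec \<sigma>"]) (auto simp: measurable_snd)
  show ?thesis
    unfolding disk_step_def Let_def case_prod_unfold by measurable
qed

lemma sum_norm_diff_mean_sq_le:
  fixes e :: "nat \<Rightarrow> 'a::real_inner"
  assumes "N > 0"
  shows "(\<Sum>i<N. (norm (e i - (1 / real N) *\<^sub>R (\<Sum>i<N. e i)))\<^sup>2) \<le> (\<Sum>i<N. (norm (e i))\<^sup>2)"
proof -
  define \<mu> where "\<mu> = (1 / real N) *\<^sub>R (\<Sum>i<N. e i)"
  have S: "(\<Sum>i<N. e i) = real N *\<^sub>R \<mu>" using assms by (simp add: \<mu>_def)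
  have "(\<Sum>i<N. (norm (e i - \<mu>))\<^sup>2) = (\<Sum>i<N. (norm (e i))\<^sup>2 - 2 * inner (e i) \<mu> + (norm \<mu>)\<^sup>2)"
    by (intro sum.cong) (auto simp: power2_norm_eq_inner inner_diff_left inner_diff_right inner_commute)
  also have "\<dots> = (\<Sum>i<N. (norm (e i))\<^sup>2) - 2 * inner (\<Sum>i<N. e i) \<mu> + real N * (norm \<mu>)\<^sup>2"
    by (simp add: sum.distrib sum_subtractf inner_sum_left sum_distrib_left)
  also have "\<dots> = (\<Sum>i<N. (norm (e i))\<^sup>2) - real N * (norm \<mu>)\<^sup>2"
    unfolding S by (simp add: power2_norm_eq_inner)
  finally show ?thesis by (simp add: \<mu>_def)
qed

text \<open>Measurability is asked of \<open>gf i\<close> for every index, because batch indices are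
  below \<open>N\<close> only almost surely. The bound on \<beta> is multiplied out, so no sign of
  the denominator has to be tracked.\<close>

locale disk_setting =
  fixes gf :: "nat \<Rightarrow> real ^ 'd \<Rightarrow> real ^ 'd"
    and F :: "real ^ 'd \<Rightarrow> real"
    and gF :: "real ^ 'd \<Rightarrow> real ^ 'd"
    and N B :: nat
    and L G \<sigma>SGD \<sigma>DP \<eta> \<gamma> \<kappa> C \<beta> R Q :: real
  assumes N_pos: "N > 0" and B_pos: "B > 0"
    and gf_measurable: "\<And>i. gf i \<in> borel_measurable borel"
    and gF_eq: "\<And>x. gF x = (1 / real N) *\<^sub>R (\<Sum>i<N. gf i x)"
    and grad_F: "\<And>x. GDERIV F x :> gF x"
    and bdd: "bdd_below (range F)"
    and lip: "\<And>i x y. i < N \<Longrightarrow> norm (gf i x - gf i y) \<le> L * norm (x - y)"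
    and var: "\<And>x. (\<Sum>i<N. (norm (gf i x - gF x))\<^sup>2) / real N \<le> \<sigma>SGD\<^sup>2"
    and bnd: "\<And>i x. i < N \<Longrightarrow> norm (gf i x) \<le> G"
    and \<sigma>DP: "\<sigma>DP \<ge> 0" and \<gamma>: "\<gamma> \<noteq> 0" and \<kappa>: "0 < \<kappa>" "\<kappa> \<le> 1" and \<eta>: "\<eta> > 0" and L: "L > 0"
    and step_size: "\<eta> * L < 1" and \<beta>: "\<beta> \<ge> 0"
    and C_bound: "C \<ge> (1 + 2 * (1 - \<kappa>) / \<kappa>) * G"
    and R_def: "R = 2 + \<bar>1 + \<gamma>\<bar> * (1 + 4 * (2 + 1 / \<kappa> + \<bar>1 + \<gamma>\<bar>) / \<gamma>\<^sup>2)"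
    and Q_def: "Q = 1 + \<bar>1 + \<gamma>\<bar> * \<kappa> + 2 * (\<eta> * L)\<^sup>2 * R"
    and \<beta>_bound: "\<eta> * (1 - \<kappa>) / 2 + \<eta>\<^sup>2 * L * (1 - \<kappa>)\<^sup>2 * Q \<le> \<beta> * (1 - (1 - \<kappa>)\<^sup>2 * Q)"
begin

definition "K = 2 * (\<beta> + \<eta>\<^sup>2 * L) * (1 - \<kappa>)\<^sup>2 * (\<eta> * L)\<^sup>2 * R"
definition "A = \<eta> * (1 + \<kappa> - 2 * \<eta> * L) / 2 - K"
definition "noise = (\<beta> + \<eta>\<^sup>2 * L) * \<kappa>\<^sup>2 * ((2 + \<bar>1 + \<gamma>\<bar>) * \<sigma>SGD\<^sup>2 / real B + real CARD('d) * \<sigma>DP\<^sup>2)"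
text \<open>The weight \<open>K\<close> is dropped while the gradient estimate vanishes. Otherwise the initial state would
  contribute an additional \<open>K (norm (gF x0))\<^sup>2\<close>.\<close>
definition "V s = F (fst s) - Inf (range F)
   + \<beta> * (norm (snd (snd s) - gF (fst s - fst (snd s))))\<^sup>2
   + (if snd (snd s) = 0 then 0 else K) * (norm (gF (fst s - fst (snd s))))\<^sup>2"
definition "noise_measure = (batch_measure N B \<Otimes>\<^sub>M gauss_vec \<sigma>DP :: ((nat \<Rightarrow> nat) \<times> (real ^ 'd)) measure)"

lemma gF_lip: "norm (gF x - gF y) \<le> L * norm (x - y)"
proof -
  have "gF x - gF y = (1 / real N) *\<^sub>R (\<Sum>i<N. gf i x - gf i y)"
    by (simp add: gF_eq sum_subtractf scaleR_diff_right)
  then have "norm (gF x - gF y) \<le> (1 / real N) * (\<Sum>i<N. norm (gf i x - gf i y))"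
    by (simp add: divide_right_mono norm_sum)
  also have "\<dots> \<le> (1 / real N) * (\<Sum>i<N. L * norm (x - y))"
    by (intro mult_left_mono sum_mono lip) auto
  finally show ?thesis using N_pos by simp
qed

lemma norm_gF_le: "norm (gF x) \<le> G"
proof -
  have "norm (gF x) \<le> (1 / real N) * (\<Sum>i<N. norm (gf i x))"
    by (simp add: gF_eq divide_right_mono norm_sum)
  also have "\<dots> \<le> (1 / real N) * (\<Sum>i<N. G)"
    by (intro mult_left_mono sum_mono bnd) auto
  finally show ?thesis using N_pos by simp
qed

lemma gF_measurable [measurable]: "gF \<in> borel_measurable borel"
proof -
  have [measurable]: "gf i \<in> borel_measurable borel" for i by (rule gf_measurable)
  have "gF = (\<lambda>x. (1 / real N) *\<^sub>R (\<Sum>i<N. gf i x))" by (simp add: gF_eq fun_eq_iff)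
  then show ?thesis by simp
qed

lemma F_measurable [measurable]: "F \<in> borel_measurable borel"
proof (rule borel_measurable_continuous_onI)
  show "continuous_on UNIV F"
    using grad_F unfolding gderiv_def by (intro continuous_at_imp_continuous_on ballI has_derivative_continuous)
qed

lemma R_nonneg: "0 \<le> R"
proof -
  have "0 \<le> 4 * (2 + 1 / \<kappa> + \<bar>1 + \<gamma>\<bar>) / \<gamma>\<^sup>2" using \<kappa> by simp
  then show ?thesis unfolding R_def by simp
qed

lemma K_nonneg: "0 \<le> K"
  using \<beta> \<eta> L R_nonneg by (simp add: K_def)

lemma gap_nonneg: "0 \<le> F x - Inf (range F)"
  using bdd cInf_lower[of "F x" "range F"] by auto

lemma V_nonneg: "0 \<le> V s"
  using gap_nonneg \<beta> K_nonneg by (auto simp: V_def intro!: add_nonneg_nonneg mult_nonneg_nonneg)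

lemma V_measurable [measurable]: "V \<in> borel_measurable (borel \<Otimes>\<^sub>M borel \<Otimes>\<^sub>M borel)"
  unfolding V_def[abs_def] by measurable

lemma noise_nonneg: "0 \<le> noise"
  using \<beta> \<eta> L by (simp add: noise_def)

lemma prob_space_noise_measure: "prob_space noise_measure"
proof -
  interpret G: prob_space "gauss_vec \<sigma>DP :: (real ^ 'd) measure" by (rule prob_space_gauss_vec[OF \<sigma>DP])
  interpret B: prob_space "batch_measure N B" by (simp add: batch_measure_def measure_pmf.prob_space_axioms)
  interpret P: pair_prob_space "batch_measure N B" "gauss_vec \<sigma>DP :: (real ^ 'd) measure" ..
  show ?thesis unfolding noise_measure_def by (rule P.prob_space_axioms)
qed

text \<open>Given the state, the new estimate is \<open>q + m\<close> plus centred noise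
  \<open>n\<close>. The descent lemma bounds the new potential pointwise by a quadratic polynomial
  in \<open>n\<close>, which integrates exactly; the mean part is then handled by
  \<open>lyapunov_drift\<close>.\<close>

lemma V_drift:
  assumes d: "d = - \<eta> *\<^sub>R p" and A: "A \<ge> 0"
  shows "(\<integral>\<^sup>+\<xi>. ennreal (V (disk_step gf B \<eta> \<gamma> \<kappa> C (x, d, p) \<xi>)) \<partial>noise_measure) + ennreal (A * (norm (gF x))\<^sup>2)
     \<le> ennreal (V (x, d, p)) + ennreal noise"
proof -
  define a where "a = (1 - \<kappa>) / (\<kappa> * \<gamma>)"
  define h where "h = 1 - \<kappa>"
  define Y where "Y i = \<kappa> *\<^sub>R clip (a *\<^sub>R gf i (x + \<gamma> *\<^sub>R d) + (1 - a) *\<^sub>R gf i x) C" for i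
  define q where "q = gF x"
  define r where "r = gF (x - d)"
  have Ld: "L * norm d = \<eta> * L * norm p" using \<eta> by (simp add: d)
  have "\<forall>i\<in>{..<N}. \<exists>e. Y i = \<kappa> *\<^sub>R gf i x + h *\<^sub>R e \<and> norm e \<le> L * norm d
      \<and> norm (gf i (x - d) - gf i x + e) \<le> 2 * (\<bar>1 + \<gamma>\<bar> / \<bar>\<gamma>\<bar>) * (L * norm d)"
    unfolding Y_def h_def
    by (intro ballI clipped_correction[OF lip bnd \<kappa> \<gamma> C_bound a_def]) auto
  then obtain e where Y: "\<And>i. i < N \<Longrightarrow> Y i = \<kappa> *\<^sub>R gf i x + h *\<^sub>R e i"
    and e: "\<And>i. i < N \<Longrightarrow> norm (e i) \<le> \<eta> * L * norm p"
    and s: "\<And>i. i < N \<Longrightarrow> norm (gf i (x - d) - gf i x + e i) \<le> 2 * (\<bar>1 + \<gamma>\<bar> / \<bar>\<gamma>\<bar>) * (\<eta> * L * norm p)"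
    unfolding Ld by (metis lessThan_iff)
  define eb where "eb = (1 / real N) *\<^sub>R (\<Sum>i<N. e i)"
  have avg: "norm ((1 / real N) *\<^sub>R (\<Sum>i<N. v i)) \<le> c" if "\<And>i. i < N \<Longrightarrow> norm (v i) \<le> c"
    for v :: "nat \<Rightarrow> real ^ 'd" and c
  proof -
    have "norm ((1 / real N) *\<^sub>R (\<Sum>i<N. v i)) \<le> (1 / real N) * (\<Sum>i<N. norm (v i))"
      by (simp add: divide_right_mono norm_sum)
    also have "\<dots> \<le> (1 / real N) * (\<Sum>i<N. c)" by (intro mult_left_mono sum_mono that) auto
    finally show ?thesis using N_pos by simp
  qed
  have eb: "norm eb \<le> \<eta> * L * norm p" unfolding eb_def by (rule avg[OF e])
  have sb: "norm (r - q + eb) \<le> 2 * (\<bar>1 + \<gamma>\<bar> / \<bar>\<gamma>\<bar>) * (\<eta> * L * norm p)"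
  proof -
    have "r - q + eb = (1 / real N) *\<^sub>R (\<Sum>i<N. gf i (x - d) - gf i x + e i)"
      by (simp add: r_def q_def eb_def gF_eq sum.distrib sum_subtractf algebra_simps)
    then show ?thesis using avg[OF s] by simp
  qed
  have qr: "norm (q - r) \<le> \<eta> * L * norm p"
    using gF_lip[of x "x - d"] unfolding q_def r_def using Ld by simp
  define m where "m = h *\<^sub>R (p - q + eb)"
  \<comment> \<open>The vector \<open>\<kappa> *\<^sub>R q + h *\<^sub>R eb\<close> is the average
    of the \<open>Y i\<close>, so \<open>Z\<close> sums to 0 over the dataset.\<close>
  define Z where "Z i = Y i - (\<kappa> *\<^sub>R q + h *\<^sub>R eb)" for i
  have Zi: "Z i = \<kappa> *\<^sub>R (gf i x - q) + h *\<^sub>R (e i - eb)" if "i < N" for i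
    using Y[OF that] by (simp add: Z_def algebra_simps)
  have "(\<Sum>i<N. Z i) = \<kappa> *\<^sub>R ((\<Sum>i<N. gf i x) - real N *\<^sub>R q) + h *\<^sub>R ((\<Sum>i<N. e i) - real N *\<^sub>R eb)"
    by (simp add: Zi sum.distrib sum_subtractf scaleR_sum_right[symmetric] sum_constant_scaleR del: sum_constant)
  then have Z0: "(\<Sum>i<N. Z i) = 0" using N_pos by (simp add: q_def eb_def gF_eq)
  define n where "n \<xi> = (1 / real B) *\<^sub>R (\<Sum>j<B. Z (fst \<xi> j)) + \<kappa> *\<^sub>R snd \<xi>" for \<xi> :: "(nat \<Rightarrow> nat) \<times> (real ^ 'd)"
  \<comment> \<open>\<open>c0\<close>, \<open>v\<close> and \<open>c2\<close> are the coefficients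
    of degree 0, 1 and 2 in \<open>n\<close>. Both the descent lemma and the estimation error
    contribute to \<open>c2\<close>.\<close>
  define c2 where "c2 = \<beta> + L * \<eta>\<^sup>2 / 2"
  define c0 where "c0 = F x - Inf (range F) - \<eta> * inner q (q + m) + L * \<eta>\<^sup>2 / 2 * (norm (q + m))\<^sup>2 + \<beta> * (norm m)\<^sup>2 + K * (norm q)\<^sup>2"
  define v where "v = - \<eta> *\<^sub>R q + (L * \<eta>\<^sup>2) *\<^sub>R (q + m) + (2 * \<beta>) *\<^sub>R m"
  have V_step: "V (disk_step gf B \<eta> \<gamma> \<kappa> C (x, d, p) \<xi>) \<le> c0 + inner v (n \<xi>) + c2 * (norm (n \<xi>))\<^sup>2" for \<xi>
  proof -
    define gt where "gt = q + m + n \<xi>"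
    have "disk_step gf B \<eta> \<gamma> \<kappa> C (x, d, p) \<xi> = (x - \<eta> *\<^sub>R gt, x - \<eta> *\<^sub>R gt - x, gt)"
    proof -
      define Sc where "Sc = (\<Sum>j<B. clip (a *\<^sub>R gf (fst \<xi> j) (x + \<gamma> *\<^sub>R d) + (1 - a) *\<^sub>R gf (fst \<xi> j) x) C)"
      have Z_sum: "(\<Sum>j<B. Z (fst \<xi> j)) = \<kappa> *\<^sub>R Sc - real B *\<^sub>R (\<kappa> *\<^sub>R q + h *\<^sub>R eb)"
        by (simp add: Z_def Y_def Sc_def sum_subtractf scaleR_sum_right sum_constant_scaleR del: sum_constant)
      have "n \<xi> = \<kappa> *\<^sub>R ((1 / real B) *\<^sub>R Sc + snd \<xi>) - (\<kappa> *\<^sub>R q + h *\<^sub>R eb)"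
        unfolding n_def Z_sum using B_pos by (simp add: scaleR_diff_right scaleR_add_right)
      then have "gt = (1 - \<kappa>) *\<^sub>R p + \<kappa> *\<^sub>R ((1 / real B) *\<^sub>R Sc + snd \<xi>)"
        by (simp add: gt_def m_def h_def algebra_simps)
      then show ?thesis by (simp add: disk_step_def Let_def Sc_def a_def)
    qed
    then have "V (disk_step gf B \<eta> \<gamma> \<kappa> C (x, d, p) \<xi>)
      = F (x - \<eta> *\<^sub>R gt) - Inf (range F) + \<beta> * (norm (gt - q))\<^sup>2 + (if gt = 0 then 0 else K) * (norm q)\<^sup>2"
      by (simp add: V_def q_def)
    also have "\<dots> \<le> F (x - \<eta> *\<^sub>R gt) - Inf (range F) + \<beta> * (norm (gt - q))\<^sup>2 + K * (norm q)\<^sup>2"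
      using K_nonneg by simp
    also have "F (x - \<eta> *\<^sub>R gt) \<le> F x - \<eta> * inner q gt + L * \<eta>\<^sup>2 / 2 * (norm gt)\<^sup>2"
      using smooth_upper_bound[of F gF L x "- \<eta> *\<^sub>R gt", OF grad_F gF_lip]
      by (simp add: q_def power_mult_distrib)
    finally have "V (disk_step gf B \<eta> \<gamma> \<kappa> C (x, d, p) \<xi>) \<le>
       F x - \<eta> * inner q gt + L * \<eta>\<^sup>2 / 2 * (norm gt)\<^sup>2 - Inf (range F) + \<beta> * (norm (gt - q))\<^sup>2 + K * (norm q)\<^sup>2"
      by simp
    also have "\<dots> = c0 + inner v (n \<xi>) + c2 * (norm (n \<xi>))\<^sup>2"
      unfolding gt_def c0_def v_def c2_def power2_norm_eq_inner
      by (simp add: inner_add_left inner_add_right inner_diff_left inner_diff_right inner_commute field_simps)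
    finally show ?thesis .
  qed
  have V_bound_nonneg: "0 \<le> c0 + inner v (n \<xi>) + c2 * (norm (n \<xi>))\<^sup>2" for \<xi>
    using V_nonneg V_step by (rule order_trans)
  note noise_integral = nn_integral_minibatch_gauss[OF N_pos B_pos \<sigma>DP Z0 V_bound_nonneg[unfolded n_def], folded n_def]
  have "(\<integral>\<^sup>+\<xi>. ennreal (V (disk_step gf B \<eta> \<gamma> \<kappa> C (x, d, p) \<xi>)) \<partial>noise_measure)
      \<le> (\<integral>\<^sup>+\<xi>. ennreal (c0 + inner v (n \<xi>) + c2 * (norm (n \<xi>))\<^sup>2) \<partial>noise_measure)"
    by (intro nn_integral_mono ennreal_leI V_step)
  also have "\<dots> = ennreal (c0 + c2 * ((\<Sum>i<N. (norm (Z i))\<^sup>2) / real N / real B + \<kappa>\<^sup>2 * (real CARD('d) * \<sigma>DP\<^sup>2)))"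
    unfolding noise_measure_def by (rule noise_integral(1))
  finally have int: "(\<integral>\<^sup>+\<xi>. ennreal (V (disk_step gf B \<eta> \<gamma> \<kappa> C (x, d, p) \<xi>)) \<partial>noise_measure)
     \<le> ennreal (c0 + c2 * ((\<Sum>i<N. (norm (Z i))\<^sup>2) / real N / real B + \<kappa>\<^sup>2 * (real CARD('d) * \<sigma>DP\<^sup>2)))" .

  define P where "P = (\<eta> * L)\<^sup>2 * (norm p)\<^sup>2"
  \<comment> \<open>Two sources of sampling noise: the spread of the gradients, bounded by A2, and
    the spread of the corrections \<open>e i\<close>, bounded by their second moment. The latter is
    proportional to \<open>(norm p)\<^sup>2\<close> and goes into the drift inequality, not into
    \<open>noise\<close>.\<close>
  have varZ: "(\<Sum>i<N. (norm (Z i))\<^sup>2) / real N \<le> 2 * \<kappa>\<^sup>2 * \<sigma>SGD\<^sup>2 + 2 * h\<^sup>2 * P"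
  proof -
    have "(norm (u + w))\<^sup>2 \<le> 2 * (norm u)\<^sup>2 + 2 * (norm w)\<^sup>2" for u w :: "real ^ 'd"
    proof -
      have "0 \<le> (norm (u - w))\<^sup>2" by simp
      then show ?thesis
        by (simp add: power2_norm_eq_inner inner_add_left inner_add_right inner_diff_left inner_diff_right inner_commute)
    qed
    then have "(norm (Z i))\<^sup>2 \<le> 2 * \<kappa>\<^sup>2 * (norm (gf i x - q))\<^sup>2 + 2 * h\<^sup>2 * (norm (e i - eb))\<^sup>2" if "i < N" for i
      using Zi[OF that] by (metis (no_types, lifting) mult.assoc norm_scaleR power2_abs power_mult_distrib)
    then have "(\<Sum>i<N. (norm (Z i))\<^sup>2) \<le> (\<Sum>i<N. 2 * \<kappa>\<^sup>2 * (norm (gf i x - q))\<^sup>2 + 2 * h\<^sup>2 * (norm (e i - eb))\<^sup>2)"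
      by (intro sum_mono) auto
    also have "\<dots> = 2 * \<kappa>\<^sup>2 * (\<Sum>i<N. (norm (gf i x - q))\<^sup>2) + 2 * h\<^sup>2 * (\<Sum>i<N. (norm (e i - eb))\<^sup>2)"
      by (simp add: sum.distrib sum_distrib_left)
    also have "\<dots> \<le> 2 * \<kappa>\<^sup>2 * (real N * \<sigma>SGD\<^sup>2) + 2 * h\<^sup>2 * (real N * P)"
    proof (intro add_mono mult_left_mono)
      show "(\<Sum>i<N. (norm (gf i x - q))\<^sup>2) \<le> real N * \<sigma>SGD\<^sup>2"
        using var[of x] N_pos by (simp add: q_def field_simps)
      have "(\<Sum>i<N. (norm (e i - eb))\<^sup>2) \<le> (\<Sum>i<N. (norm (e i))\<^sup>2)"
        unfolding eb_def by (rule sum_norm_diff_mean_sq_le[OF N_pos])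
      also have "\<dots> \<le> (\<Sum>i<N. (\<eta> * L * norm p)\<^sup>2)"
        by (intro sum_mono power_mono e) auto
      finally show "(\<Sum>i<N. (norm (e i - eb))\<^sup>2) \<le> real N * P"
        by (simp add: P_def power_mult_distrib)
    qed auto
    finally show ?thesis using N_pos by (simp add: field_simps)
  qed
  have c2: "0 \<le> c2" "c2 \<le> \<beta> + \<eta>\<^sup>2 * L" using \<beta> L \<eta> by (auto simp: c2_def)
  have "c2 * ((\<Sum>i<N. (norm (Z i))\<^sup>2) / real N / real B + \<kappa>\<^sup>2 * (real CARD('d) * \<sigma>DP\<^sup>2))
      \<le> c2 * ((2 * \<kappa>\<^sup>2 * \<sigma>SGD\<^sup>2 / real B + 2 * h\<^sup>2 * P) + \<kappa>\<^sup>2 * (real CARD('d) * \<sigma>DP\<^sup>2))"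
  proof (intro mult_left_mono add_right_mono c2)
    have "(\<Sum>i<N. (norm (Z i))\<^sup>2) / real N / real B \<le> (2 * \<kappa>\<^sup>2 * \<sigma>SGD\<^sup>2 + 2 * h\<^sup>2 * P) / real B"
      using varZ by (intro divide_right_mono) auto
    \<comment> \<open>The factor \<open>1 / real B\<close> is given up for the corrections only,
      since the drift inequality pays for them in full.\<close>
    also have "\<dots> \<le> 2 * \<kappa>\<^sup>2 * \<sigma>SGD\<^sup>2 / real B + 2 * h\<^sup>2 * P"
    proof -
      have "2 * h\<^sup>2 * P / real B \<le> 2 * h\<^sup>2 * P / 1"
        using B_pos by (intro divide_left_mono) (auto simp: P_def)
      then show ?thesis by (simp add: add_divide_distrib)
    qed
    finally show "(\<Sum>i<N. (norm (Z i))\<^sup>2) / real N / real B \<le> 2 * \<kappa>\<^sup>2 * \<sigma>SGD\<^sup>2 / real B + 2 * h\<^sup>2 * P" .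
  qed
  also have "\<dots> = c2 * (2 * h\<^sup>2 * P) + c2 * (\<kappa>\<^sup>2 * (2 * \<sigma>SGD\<^sup>2 / real B + real CARD('d) * \<sigma>DP\<^sup>2))"
    by (simp add: algebra_simps)
  also have "c2 * (\<kappa>\<^sup>2 * (2 * \<sigma>SGD\<^sup>2 / real B + real CARD('d) * \<sigma>DP\<^sup>2)) \<le> noise"
    unfolding noise_def mult.assoc[of "\<beta> + \<eta>\<^sup>2 * L"]
    using c2 by (intro mult_mono mult_left_mono add_right_mono divide_right_mono mult_right_mono) auto
  finally have noise: "c2 * ((\<Sum>i<N. (norm (Z i))\<^sup>2) / real N / real B + \<kappa>\<^sup>2 * (real CARD('d) * \<sigma>DP\<^sup>2))
     \<le> c2 * (2 * h\<^sup>2 * P) + noise" by simp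
  define k where "k = (if p = 0 then 0 else K)"
  have "\<eta> * (1 + \<kappa> - 2 * \<eta> * L) / 2 * (norm q)\<^sup>2
      - \<eta> * inner q (q + m) + L * \<eta>\<^sup>2 / 2 * (norm (q + m))\<^sup>2 + \<beta> * (norm m)\<^sup>2
      + (\<beta> + L * \<eta>\<^sup>2 / 2) * (2 * (1 - \<kappa>)\<^sup>2 * (\<eta> * L)\<^sup>2 * (norm p)\<^sup>2)
      \<le> \<beta> * (norm (p - r))\<^sup>2 + k * (norm r)\<^sup>2"
    by (rule lyapunov_drift[OF \<eta> L step_size \<kappa> \<gamma> \<beta> R_def \<beta>_bound Q_def qr eb sb])
       (simp_all add: k_def K_def m_def h_def)
  then have "c0 + c2 * (2 * h\<^sup>2 * P) + A * (norm q)\<^sup>2 \<le> V (x, d, p)"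
    by (simp add: c0_def c2_def P_def h_def A_def V_def k_def r_def algebra_simps)
  with noise have fin: "c0 + c2 * ((\<Sum>i<N. (norm (Z i))\<^sup>2) / real N / real B + \<kappa>\<^sup>2 * (real CARD('d) * \<sigma>DP\<^sup>2)) + A * (norm q)\<^sup>2
     \<le> V (x, d, p) + noise" by linarith
  have nn: "0 \<le> c0 + c2 * ((\<Sum>i<N. (norm (Z i))\<^sup>2) / real N / real B + \<kappa>\<^sup>2 * (real CARD('d) * \<sigma>DP\<^sup>2))"
    by (rule noise_integral(2))
  have "(\<integral>\<^sup>+\<xi>. ennreal (V (disk_step gf B \<eta> \<gamma> \<kappa> C (x, d, p) \<xi>)) \<partial>noise_measure) + ennreal (A * (norm (gF x))\<^sup>2)
     \<le> ennreal (c0 + c2 * ((\<Sum>i<N. (norm (Z i))\<^sup>2) / real N / real B + \<kappa>\<^sup>2 * (real CARD('d) * \<sigma>DP\<^sup>2))) + ennreal (A * (norm q)\<^sup>2)"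
    unfolding q_def[symmetric] by (intro add_right_mono int)
  also have "\<dots> \<le> ennreal (V (x, d, p) + noise)"
    using ennreal_leI[OF fin] ennreal_plus[OF nn mult_nonneg_nonneg[OF A zero_le_power2]] by metis
  finally show ?thesis using V_nonneg noise_nonneg by simp
qed

lemma disk_space_eq: "disk_space N B \<sigma>DP T = PiM {..<T} (\<lambda>_. noise_measure)"
  by (simp add: disk_space_def noise_measure_def)

lemma prob_space_disk_space: "prob_space (disk_space N B \<sigma>DP T :: (nat \<Rightarrow> (nat \<Rightarrow> nat) \<times> (real ^ 'd)) measure)"
  unfolding disk_space_eq by (intro prob_space_PiM prob_space_noise_measure)

lemma disk_step_measurable:
  "(\<lambda>(s, \<xi>). disk_step gf B \<eta> \<gamma> \<kappa> C s \<xi>)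
    \<in> (borel \<Otimes>\<^sub>M borel \<Otimes>\<^sub>M borel) \<Otimes>\<^sub>M noise_measure \<rightarrow>\<^sub>M borel \<Otimes>\<^sub>M borel \<Otimes>\<^sub>M borel"
  unfolding noise_measure_def by (rule measurable_disk_step[OF gf_measurable])

lemma mem_space_borel_triple: "s \<in> space (borel \<Otimes>\<^sub>M borel \<Otimes>\<^sub>M borel)"
  by (cases s) (simp add: space_pair_measure)

lemma disk_state_measurable:
  assumes "t \<le> T"
  shows "(\<lambda>\<omega>. disk_state gf B x0 \<eta> \<gamma> \<kappa> C \<omega> t) \<in> disk_space N B \<sigma>DP T \<rightarrow>\<^sub>M borel \<Otimes>\<^sub>M borel \<Otimes>\<^sub>M borel"
  unfolding disk_space_eq
  by (rule measurable_iterated_step[where S = "disk_state gf B x0 \<eta> \<gamma> \<kappa> C"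
        and init = "(x0, 0, 0)", OF disk_state.simps(1) disk_state_Suc_step disk_step_measurable mem_space_borel_triple assms])

lemma norm_gF_disk_x_sq_measurable:
  assumes "t \<le> T"
  shows "(\<lambda>\<omega>. (norm (gF (disk_x gf B x0 \<eta> \<gamma> \<kappa> C \<omega> t)))\<^sup>2) \<in> borel_measurable (disk_space N B \<sigma>DP T)"
proof -
  note [measurable] = disk_state_measurable[OF assms, of x0]
  show ?thesis unfolding disk_x_def by measurable
qed

lemma integrable_norm_gF_disk_x_sq:
  assumes "t \<le> T"
  shows "integrable (disk_space N B \<sigma>DP T) (\<lambda>\<omega>. (norm (gF (disk_x gf B x0 \<eta> \<gamma> \<kappa> C \<omega> t)))\<^sup>2)"
proof -
  interpret prob_space "disk_space N B \<sigma>DP T :: (nat \<Rightarrow> (nat \<Rightarrow> nat) \<times> (real ^ 'd)) measure"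
    by (rule prob_space_disk_space)
  show ?thesis
    by (rule integrable_const_bound[of _ "G\<^sup>2"])
       (auto intro!: power_mono norm_gF_le norm_gF_disk_x_sq_measurable assms)
qed

text \<open>This bounds the summand \<open>t = T\<close> by the potential alone, so that the \<open>T + 1\<close> summands
  cost only \<open>T\<close> steps of noise.\<close>
lemma A_norm_gF_sq_le_gap:
  assumes "A \<ge> 0"
  shows "A * (norm (gF x))\<^sup>2 \<le> F x - Inf (range F)"
proof -
  have "A \<le> \<eta> * (1 - \<eta> * L)"
  proof -
    have "\<eta> * \<kappa> \<le> \<eta>" using \<eta> \<kappa> by simp
    then have "\<eta> * (1 + \<kappa> - 2 * \<eta> * L) / 2 \<le> \<eta> * (1 - \<eta> * L)" by (simp add: field_simps)
    then show ?thesis using K_nonneg by (simp add: A_def)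
  qed
  then have "2 * L * A \<le> 2 * L * (\<eta> * (1 - \<eta> * L))" using L by (intro mult_left_mono) auto
  also have "\<dots> = 1 / 2 - 2 * (\<eta> * L - 1 / 2)\<^sup>2" by (simp add: power2_eq_square field_simps)
  also have "\<dots> \<le> 1" using zero_le_power2[of "\<eta> * L - 1 / 2"] by linarith
  finally have LA: "2 * L * A \<le> 1" .
  have "A * (norm (gF x))\<^sup>2 \<le> A * (2 * L * (F x - Inf (range F)))"
    by (intro mult_left_mono norm_gradient_sq_le_gap grad_F gF_lip bdd L assms)
  also have "\<dots> = (2 * L * A) * (F x - Inf (range F))" by simp
  also have "\<dots> \<le> 1 * (F x - Inf (range F))" by (intro mult_right_mono LA gap_nonneg)
  finally show ?thesis by simp
qed

lemma sum_expectation_norm_gF_sq_le: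
  assumes A: "A \<ge> 0"
  shows "A * (\<Sum>t\<in>{0..T}. \<integral>\<omega>. (norm (gF (disk_x gf B x0 \<eta> \<gamma> \<kappa> C \<omega> t)))\<^sup>2 \<partial>disk_space N B \<sigma>DP T)
    \<le> F x0 - Inf (range F) + \<beta> * (norm (gF x0))\<^sup>2 + real T * noise"
proof -
  let ?S = "disk_state gf B x0 \<eta> \<gamma> \<kappa> C"
  let ?q = "\<lambda>t \<omega>. A * (norm (gF (disk_x gf B x0 \<eta> \<gamma> \<kappa> C \<omega> t)))\<^sup>2"
  let ?X = "F x0 - Inf (range F) + \<beta> * (norm (gF x0))\<^sup>2 + real T * noise"
  have drift: "(\<integral>\<^sup>+\<omega>. ennreal (V (?S \<omega> T)) + (\<Sum>t<T. ennreal (?q t \<omega>)) \<partial>disk_space N B \<sigma>DP T)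
     \<le> ennreal (V (x0, 0, 0)) + of_nat T * ennreal noise"
    unfolding disk_space_eq disk_x_def
  proof (rule iterated_step_drift_bound[where S = ?S and init = "(x0, 0, 0)"
        and c = "\<lambda>s. ennreal (A * (norm (gF (fst s)))\<^sup>2)" and U = "\<lambda>s. ennreal (V s)"
        and I = "\<lambda>s. fst (snd s) = - \<eta> *\<^sub>R snd (snd s)",
        OF prob_space_noise_measure disk_state.simps(1) disk_state_Suc_step disk_step_measurable mem_space_borel_triple])
    \<comment> \<open>The drift estimate needs the displacement to be tied to the gradient estimate.
      Every step restores this relation, and it holds initially with both equal to 0.\<close>
    show "fst (snd (disk_step gf B \<eta> \<gamma> \<kappa> C s \<xi>)) = - \<eta> *\<^sub>R snd (snd (disk_step gf B \<eta> \<gamma> \<kappa> C s \<xi>))" for s \<xi>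
      by (simp add: disk_step_def Let_def)
    show "(\<integral>\<^sup>+\<xi>. ennreal (V (disk_step gf B \<eta> \<gamma> \<kappa> C s \<xi>)) \<partial>noise_measure) + ennreal (A * (norm (gF (fst s)))\<^sup>2)
        \<le> ennreal (V s) + ennreal noise" if "fst (snd s) = - \<eta> *\<^sub>R snd (snd s)" for s
      using V_drift[OF that A, of "fst s"] by simp
    show "(\<lambda>s. ennreal (V s)) \<in> borel_measurable (borel \<Otimes>\<^sub>M borel \<Otimes>\<^sub>M borel)"
      by (rule measurable_compose[OF V_measurable measurable_ennreal])
    show "(\<lambda>s. ennreal (A * (norm (gF (fst s)))\<^sup>2)) \<in> borel_measurable (borel \<Otimes>\<^sub>M (borel \<Otimes>\<^sub>M borel :: ((real ^ 'd) \<times> (real ^ 'd)) measure))"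
      by measurable
  qed simp
  have last: "?q T \<omega> \<le> V (?S \<omega> T)" for \<omega>
  proof -
    have "?q T \<omega> \<le> F (fst (?S \<omega> T)) - Inf (range F)"
      unfolding disk_x_def by (rule A_norm_gF_sq_le_gap[OF A])
    also have "\<dots> \<le> V (?S \<omega> T)" using \<beta> K_nonneg by (simp add: V_def)
    finally show ?thesis .
  qed
  have q_nn: "0 \<le> ?q t \<omega>" for t \<omega> using A by simp
  \<comment> \<open>With displacement and estimate both 0, the previous gradient is
    \<open>gF x0\<close>: the error term becomes \<open>\<beta> * (norm (gF x0))\<^sup>2\<close> and
    the weight \<open>K\<close> is off, which matches the stated initial constant.\<close>
  have X: "ennreal (V (x0, 0, 0)) + of_nat T * ennreal noise = ennreal ?X"
    using gap_nonneg[of x0] \<beta> noise_nonneg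
    by (simp add: V_def ennreal_of_nat_eq_real_of_nat flip: ennreal_mult' ennreal_plus)
  have X0: "0 \<le> ?X" using gap_nonneg[of x0] \<beta> noise_nonneg by simp
  have int: "integrable (disk_space N B \<sigma>DP T) (\<lambda>\<omega>. \<Sum>t\<in>{0..T}. ?q t \<omega>)"
    by (intro Bochner_Integration.integrable_sum integrable_mult_right integrable_norm_gF_disk_x_sq) auto
  have "ennreal (\<integral>\<omega>. (\<Sum>t\<in>{0..T}. ?q t \<omega>) \<partial>disk_space N B \<sigma>DP T)
      = (\<integral>\<^sup>+\<omega>. ennreal (\<Sum>t\<in>{0..T}. ?q t \<omega>) \<partial>disk_space N B \<sigma>DP T)"
    using q_nn by (intro nn_integral_eq_integral[symmetric] int) (auto intro!: sum_nonneg)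
  also have "\<dots> \<le> (\<integral>\<^sup>+\<omega>. ennreal (V (?S \<omega> T)) + (\<Sum>t<T. ennreal (?q t \<omega>)) \<partial>disk_space N B \<sigma>DP T)"
  proof (rule nn_integral_mono)
    fix \<omega>
    have "(\<Sum>t\<in>{0..T}. ?q t \<omega>) = ?q T \<omega> + (\<Sum>t<T. ?q t \<omega>)"
      by (simp add: atLeast0AtMost lessThan_Suc_atMost[symmetric])
    also have "\<dots> \<le> V (?S \<omega> T) + (\<Sum>t<T. ?q t \<omega>)" using last by simp
    finally have "ennreal (\<Sum>t\<in>{0..T}. ?q t \<omega>) \<le> ennreal (V (?S \<omega> T) + (\<Sum>t<T. ?q t \<omega>))"
      by (rule ennreal_leI)
    then show "ennreal (\<Sum>t\<in>{0..T}. ?q t \<omega>) \<le> ennreal (V (?S \<omega> T)) + (\<Sum>t<T. ennreal (?q t \<omega>))"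
      using q_nn V_nonneg by (simp add: sum_nonneg)
  qed
  also have "\<dots> \<le> ennreal ?X" using drift unfolding X .
  finally have "(\<integral>\<omega>. (\<Sum>t\<in>{0..T}. ?q t \<omega>) \<partial>disk_space N B \<sigma>DP T) \<le> ?X"
    using X0 by (simp add: ennreal_le_iff)
  also have "(\<integral>\<omega>. (\<Sum>t\<in>{0..T}. ?q t \<omega>) \<partial>disk_space N B \<sigma>DP T)
     = (\<Sum>t\<in>{0..T}. \<integral>\<omega>. ?q t \<omega> \<partial>disk_space N B \<sigma>DP T)"
    by (intro Bochner_Integration.integral_sum integrable_mult_right integrable_norm_gF_disk_x_sq) auto
  finally show ?thesis by (simp add: sum_distrib_left)
qed

end

section \<open>Passage to gradient families constrained only below N, and the final bound\<close>

lemma AE_disk_space_indices: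
  assumes N: "N > 0" and \<sigma>: "\<sigma> \<ge> 0"
  shows "AE \<omega> in (disk_space N B \<sigma> T :: (nat \<Rightarrow> (nat \<Rightarrow> nat) \<times> (real ^ 'd)) measure). \<forall>t<T. \<forall>j<B. fst (\<omega> t) j < N"
proof -
  let ?G = "gauss_vec \<sigma> :: (real ^ 'd) measure"
  interpret G: prob_space ?G by (rule prob_space_gauss_vec[OF \<sigma>])
  interpret B: prob_space "batch_measure N B" by (simp add: batch_measure_def measure_pmf.prob_space_axioms)
  interpret P: pair_prob_space "batch_measure N B" ?G ..
  have ne: "{..<N} \<noteq> {}" using N by auto
  have idx: "AE b in batch_measure N B. \<forall>j<B. b j < N"
    unfolding batch_measure_def AE_measure_pmf_iff
  proof (intro ballI allI impI)
    fix b j assume b: "b \<in> set_pmf (Pi_pmf {..<B} 0 (\<lambda>_. pmf_of_set {..<N}))" and j: "j < B"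
    have "b j \<in> set_pmf (pmf_of_set {..<N})"
      using b j unfolding set_Pi_pmf[OF finite_lessThan] by (simp add: PiE_dflt_def)
    then show "b j < N" unfolding set_pmf_of_set[OF ne finite_lessThan] by simp
  qed
  have pair: "AE \<xi> in batch_measure N B \<Otimes>\<^sub>M ?G. \<forall>j<B. fst \<xi> j < N"
  proof (rule P.AE_pair_measure)
    have "Measurable.pred (batch_measure N B) (\<lambda>b. \<forall>j<B. b j < N)" by (simp add: batch_measure_def)
    from predE[OF measurable_compose[OF measurable_fst this]]
    show "{\<xi> \<in> space (batch_measure N B \<Otimes>\<^sub>M ?G). \<forall>j<B. fst \<xi> j < N} \<in> sets (batch_measure N B \<Otimes>\<^sub>M ?G)" .
    show "AE b in batch_measure N B. AE w in ?G. \<forall>j<B. fst (b, w) j < N"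
      using idx by eventually_elim simp
  qed
  have comp: "AE \<omega> in (disk_space N B \<sigma> T :: (nat \<Rightarrow> (nat \<Rightarrow> nat) \<times> (real ^ 'd)) measure). \<forall>j<B. fst (\<omega> t) j < N" if "t < T" for t
    unfolding disk_space_def
    by (rule AE_PiM_component[where P = "\<lambda>\<xi>. \<forall>j<B. fst \<xi> j < N", OF P.prob_space_axioms _ pair]) (use that in simp)
  have "AE \<omega> in (disk_space N B \<sigma> T :: (nat \<Rightarrow> (nat \<Rightarrow> nat) \<times> (real ^ 'd)) measure). \<forall>t\<in>{..<T}. \<forall>j<B. fst (\<omega> t) j < N"
    by (intro AE_finite_allI comp) auto
  then show ?thesis by (simp only: Ball_def lessThan_iff)
qed

lemma disk_state_cong:
  assumes "\<And>s j. s < T \<Longrightarrow> j < B \<Longrightarrow> gf (fst (\<omega> s) j) = gf' (fst (\<omega> s) j)" and "t \<le> T"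
  shows "disk_state gf B x0 \<eta> \<gamma> \<kappa> C \<omega> t = disk_state gf' B x0 \<eta> \<gamma> \<kappa> C \<omega> t"
  using assms(2)
proof (induction t)
  case (Suc t)
  then have "disk_step gf B \<eta> \<gamma> \<kappa> C s (\<omega> t) = disk_step gf' B \<eta> \<gamma> \<kappa> C s (\<omega> t)" for s
    using assms(1)[of t] by (simp add: disk_step_def Let_def)
  with Suc show ?case unfolding disk_state_Suc_step by simp
qed simp

text \<open>No measurability of \<open>f\<close> is required, because a non-integrable function has integral 0. This
  matters since the gradients \<open>gf i\<close> with \<open>i \<ge> N\<close> are arbitrary functions.\<close>
lemma integral_le_integral_AE_eq:
  fixes f g :: "'a \<Rightarrow> real"
  assumes "AE x in M. f x = g x" and [measurable]: "g \<in> borel_measurable M" and "\<And>x. 0 \<le> g x"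
  shows "integral\<^sup>L M f \<le> integral\<^sup>L M g"
proof (cases "f \<in> borel_measurable M")
  case True
  show ?thesis using integral_cong_AE[OF True assms(2,1)] by simp
next
  case False
  then have "integral\<^sup>L M f = 0" using borel_measurable_integrable not_integrable_integral_eq by blast
  then show ?thesis using assms(3) by simp
qed

theorem theorem2:
  fixes f :: "nat \<Rightarrow> real ^ 'd \<Rightarrow> real"
    and gf :: "nat \<Rightarrow> real ^ 'd \<Rightarrow> real ^ 'd"
    and F :: "real ^ 'd \<Rightarrow> real"
    and gF :: "real ^ 'd \<Rightarrow> real ^ 'd"
    and N B T :: nat
    and x0 :: "real ^ 'd"
    and L G \<sigma>SGD \<sigma>DP \<eta> \<gamma> \<kappa> C \<beta> :: real
  assumes N_pos: "N > 0"
    and F_def: "\<And>x. F x = (\<Sum>i<N. f i x) / real N"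
    and grad_f: "\<And>i x. i < N \<Longrightarrow> GDERIV (f i) x :> gf i x"
    and grad_F: "\<And>x. GDERIV F x :> gF x"
    and Fstar_finite: "bdd_below (range F)"
    and A1: "\<And>i x y. i < N \<Longrightarrow> norm (gf i x - gf i y) \<le> L * norm (x - y)"
    and A2: "\<And>x. (\<Sum>i<N. (norm (gf i x - gF x))\<^sup>2) / real N \<le> \<sigma>SGD\<^sup>2"
    and A3: "\<And>i x. i < N \<Longrightarrow> norm (gf i x) \<le> G"
    and B_pos: "B \<ge> 1"
    and T_pos: "T \<ge> 1"
    and sigDP: "\<sigma>DP \<ge> 0"
    and gamma_nz: "\<gamma> \<noteq> 0"
    and kappa: "0 < \<kappa>" "\<kappa> \<le> 1"
    and eta_pos: "\<eta> > 0"
    and C_bound: "C \<ge> (1 + 2 * (1 - \<kappa>) / \<kappa>) * G"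
    and beta_nonneg: "\<beta> \<ge> 0"
    and beta_bound:
      "\<beta> \<ge> (\<eta> * (1 - \<kappa>) / 2 + \<eta>\<^sup>2 * L * (1 - \<kappa>)\<^sup>2
              * (1 + 4 * \<eta>\<^sup>2 * L\<^sup>2 + \<bar>1 + \<gamma>\<bar> * (\<kappa> + 2 * \<eta>\<^sup>2 * L\<^sup>2 * (1 + 4 * (2 + 1 / \<kappa> + \<bar>1 + \<gamma>\<bar>) / \<gamma>\<^sup>2))))
           / (1 - (1 - \<kappa>)\<^sup>2 * (1 + 4 * \<eta>\<^sup>2 * L\<^sup>2 + \<bar>1 + \<gamma>\<bar> * (\<kappa> + 2 * \<eta>\<^sup>2 * L\<^sup>2 * (1 + 4 * (2 + 1 / \<kappa> + \<bar>1 + \<gamma>\<bar>) / \<gamma>\<^sup>2))))"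
    and eta_bound:
      "\<eta> < (1 + \<kappa>) / (2 * L * (1 + 2 * (1 - \<kappa>)\<^sup>2 * \<beta> * L
              * (2 + \<bar>1 + \<gamma>\<bar> * (1 + 4 * (2 + 1 / \<kappa> + \<bar>1 + \<gamma>\<bar>) / \<gamma>\<^sup>2))))"
    and kappa_bound:
      "\<kappa> > 1 - 1 / sqrt (1 + 4 * \<eta>\<^sup>2 * L\<^sup>2 + \<bar>1 + \<gamma>\<bar> * (\<kappa> + 2 * \<eta>\<^sup>2 * L\<^sup>2 * (1 + 4 * (2 + 1 / \<kappa> + \<bar>1 + \<gamma>\<bar>) / \<gamma>\<^sup>2)))"
    and M1_pos:
      "(1 + \<kappa> - 2 * \<eta> * L) - 4 * (\<beta> + \<eta>\<^sup>2 * L) * (1 - \<kappa>)\<^sup>2 * L\<^sup>2 * \<eta>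
          * (2 + \<bar>1 + \<gamma>\<bar> * (1 + 4 * (2 + 1 / \<kappa> + \<bar>1 + \<gamma>\<bar>) / \<gamma>\<^sup>2)) > 0"
  shows
    "(let M\<gamma> = 1 + 4 * (2 + 1 / \<kappa> + \<bar>1 + \<gamma>\<bar>) / \<gamma>\<^sup>2;
          M1 = (1 + \<kappa> - 2 * \<eta> * L) - 4 * (\<beta> + \<eta>\<^sup>2 * L) * (1 - \<kappa>)\<^sup>2 * L\<^sup>2 * \<eta> * (2 + \<bar>1 + \<gamma>\<bar> * M\<gamma>);
          Fstar = Inf (range F)
      in (1 / real T) * (\<Sum>t\<in>{0..T}.
              (\<integral>\<omega>. (norm (gF (disk_x gf B x0 \<eta> \<gamma> \<kappa> C \<omega> t)))\<^sup>2 \<partial>(disk_space N B \<sigma>DP T)))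
         \<le> 2 * (F x0 + \<beta> * (norm (gF x0))\<^sup>2 - Fstar) / (M1 * \<eta> * real T)
           + 2 * (\<beta> + \<eta>\<^sup>2 * L) * \<kappa>\<^sup>2 / (M1 * \<eta>)
             * ((2 + \<bar>1 + \<gamma>\<bar>) * \<sigma>SGD\<^sup>2 / real B + real CARD('d) * \<sigma>DP\<^sup>2))"
proof -
  define M\<gamma> where "M\<gamma> = 1 + 4 * (2 + 1 / \<kappa> + \<bar>1 + \<gamma>\<bar>) / \<gamma>\<^sup>2"
  define R where "R = 2 + \<bar>1 + \<gamma>\<bar> * M\<gamma>"
  define Q where "Q = 1 + 4 * \<eta>\<^sup>2 * L\<^sup>2 + \<bar>1 + \<gamma>\<bar> * (\<kappa> + 2 * \<eta>\<^sup>2 * L\<^sup>2 * M\<gamma>)"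
  define M1 where "M1 = (1 + \<kappa> - 2 * \<eta> * L) - 4 * (\<beta> + \<eta>\<^sup>2 * L) * (1 - \<kappa>)\<^sup>2 * L\<^sup>2 * \<eta> * R"
  have M\<gamma>: "1 \<le> M\<gamma>" using kappa by (simp add: M\<gamma>_def)
  have R2: "2 \<le> R" using M\<gamma> by (simp add: R_def)
  have M1: "M1 > 0" using M1_pos unfolding M1_def R_def M\<gamma>_def .
  \<comment> \<open>The sign of \<open>L\<close> follows from A1 at two distinct points, the
    all-ones vector and 0, since the index type is nonempty.\<close>
  have L_nonneg: "0 \<le> L"
  proof -
    have "0 \<le> L * norm (1 - 0 :: real ^ 'd)"
      using A1[OF N_pos, of 1 0] by (rule order_trans[OF norm_ge_zero])
    moreover have "0 < norm (1 :: real ^ 'd)" by simp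
    ultimately show ?thesis by (simp add: zero_le_mult_iff)
  qed
  \<comment> \<open>For \<open>L = 0\<close> the right-hand side of \<open>eta_bound\<close> is a
    division by zero, hence 0, which contradicts \<eta> > 0.\<close>
  have L_pos: "L > 0"
    using L_nonneg eta_bound eta_pos by (cases "L = 0") auto
  \<comment> \<open>Positivity of \<open>M1\<close> gives
    \<open>2 * \<eta> * L < 1 + \<kappa>\<close>, and \<kappa> is at most 1.\<close>
  have step_size: "\<eta> * L < 1"
  proof -
    have "0 \<le> 4 * (\<beta> + \<eta>\<^sup>2 * L) * (1 - \<kappa>)\<^sup>2 * L\<^sup>2 * \<eta> * R"
      using beta_nonneg eta_pos L_nonneg R2 by simp
    then show ?thesis using M1 kappa unfolding M1_def by linarith
  qed
  have Q1: "1 \<le> Q"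
    using M\<gamma> kappa by (simp add: Q_def)
  have Q_lt: "(1 - \<kappa>)\<^sup>2 * Q < 1"
  proof -
    have "(1 - \<kappa>) < 1 / sqrt Q" using kappa_bound unfolding Q_def M\<gamma>_def by simp
    then have "(1 - \<kappa>) * sqrt Q < 1" using Q1 by (simp add: field_simps)
    moreover have "0 \<le> (1 - \<kappa>) * sqrt Q" using kappa Q1 by simp
    ultimately have "((1 - \<kappa>) * sqrt Q)\<^sup>2 < 1" by (simp add: power_less_one_iff abs_square_less_1)
    then show ?thesis using Q1 by (simp add: power_mult_distrib)
  qed
  have beta': "\<eta> * (1 - \<kappa>) / 2 + \<eta>\<^sup>2 * L * (1 - \<kappa>)\<^sup>2 * Q \<le> \<beta> * (1 - (1 - \<kappa>)\<^sup>2 * Q)"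
  proof -
    have "(\<eta> * (1 - \<kappa>) / 2 + \<eta>\<^sup>2 * L * (1 - \<kappa>)\<^sup>2 * Q) / (1 - (1 - \<kappa>)\<^sup>2 * Q) \<le> \<beta>"
      using beta_bound unfolding Q_def M\<gamma>_def .
    then show ?thesis using Q_lt by (subst (asm) pos_divide_le_eq) auto
  qed
  \<comment> \<open>Indices from \<open>N\<close> on are drawn with probability 0, so zero gradients
    there change the iterates only on a null set while making every \<open>gf' i\<close>
    measurable.\<close>
  define gf' where "gf' i = (if i < N then gf i else (\<lambda>_. 0))" for i
  \<comment> \<open>\<open>gF\<close> is given only as a gradient of \<open>F\<close>; uniqueness of
    derivatives identifies it with the average of the \<open>gf i\<close>.\<close>
  have gF_eq: "gF x = (1 / real N) *\<^sub>R (\<Sum>i<N. gf i x)" for x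
  proof -
    have "((\<lambda>x. (\<Sum>i<N. f i x) / real N) has_derivative (\<lambda>h. (\<Sum>i<N. inner h (gf i x)) / real N)) (at x)"
      using grad_f N_pos unfolding gderiv_def by (auto intro!: derivative_eq_intros)
    then have "(F has_derivative (\<lambda>h. (\<Sum>i<N. inner h (gf i x)) / real N)) (at x)"
      by (simp add: F_def[abs_def])
    moreover have "(F has_derivative (\<lambda>h. inner h (gF x))) (at x)"
      using grad_F unfolding gderiv_def .
    ultimately have "(\<lambda>h. (\<Sum>i<N. inner h (gf i x)) / real N) = (\<lambda>h. inner h (gF x))"
      by (rule has_derivative_unique)
    then have "inner h (gF x) = inner h ((1 / real N) *\<^sub>R (\<Sum>i<N. gf i x))" for h
      by (simp add: inner_sum_right fun_eq_iff)
    then show ?thesis by (metis vector_eq_ldot)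
  qed
  interpret disk_setting gf' F gF N B L G \<sigma>SGD \<sigma>DP \<eta> \<gamma> \<kappa> C \<beta> R Q
  proof
    show "gf' i \<in> borel_measurable borel" for i
    proof (cases "i < N")
      case True
      have "L-lipschitz_on UNIV (gf i)"
        using A1[OF True] L_nonneg by (auto intro!: lipschitz_onI simp: dist_norm)
      then show ?thesis using True
        by (auto simp: gf'_def intro!: borel_measurable_continuous_onI lipschitz_on_continuous_on)
    qed (simp add: gf'_def)
    show "R = 2 + \<bar>1 + \<gamma>\<bar> * (1 + 4 * (2 + 1 / \<kappa> + \<bar>1 + \<gamma>\<bar>) / \<gamma>\<^sup>2)" by (simp add: R_def M\<gamma>_def)
    show "Q = 1 + \<bar>1 + \<gamma>\<bar> * \<kappa> + 2 * (\<eta> * L)\<^sup>2 * R"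
      by (simp add: R_def Q_def power_mult_distrib algebra_simps)
    show "gF x = (1 / real N) *\<^sub>R (\<Sum>i<N. gf' i x)" for x by (simp add: gF_eq gf'_def)
    show "norm (gf' i x - gf' i y) \<le> L * norm (x - y)" if "i < N" for i x y
      using A1[OF that] that by (simp add: gf'_def)
    show "(\<Sum>i<N. (norm (gf' i x - gF x))\<^sup>2) / real N \<le> \<sigma>SGD\<^sup>2" for x
      using A2[of x] by (simp add: gf'_def)
    show "norm (gf' i x) \<le> G" if "i < N" for i x
      using A3[OF that] that by (simp add: gf'_def)
    show "0 < B" using B_pos by simp
  qed (rule N_pos grad_F Fstar_finite sigDP gamma_nz kappa eta_pos L_pos step_size beta_nonneg C_bound beta')+
  have A_eq: "A = M1 * \<eta> / 2"
  proof -
    define X where "X = 4 * (\<beta> + \<eta>\<^sup>2 * L) * (1 - \<kappa>)\<^sup>2 * L\<^sup>2 * \<eta> * R"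
    have "K = X * \<eta> / 2"
      unfolding K_def X_def power_mult_distrib by (simp add: power2_eq_square[of \<eta>])
    then show ?thesis unfolding A_def M1_def X_def[symmetric] by (simp add: field_simps)
  qed
  have A_pos: "A > 0" using M1 eta_pos by (simp add: A_eq)
  let ?I = "\<lambda>g t. \<integral>\<omega>. (norm (gF (disk_x g B x0 \<eta> \<gamma> \<kappa> C \<omega> t)))\<^sup>2 \<partial>disk_space N B \<sigma>DP T"
  have "?I gf t \<le> ?I gf' t" if "t \<le> T" for t
  proof (rule integral_le_integral_AE_eq)
    show "AE \<omega> in disk_space N B \<sigma>DP T. (norm (gF (disk_x gf B x0 \<eta> \<gamma> \<kappa> C \<omega> t)))\<^sup>2
        = (norm (gF (disk_x gf' B x0 \<eta> \<gamma> \<kappa> C \<omega> t)))\<^sup>2"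
      using AE_disk_space_indices[OF N_pos sigDP]
    proof eventually_elim
      case (elim \<omega>)
      have "disk_state gf B x0 \<eta> \<gamma> \<kappa> C \<omega> t = disk_state gf' B x0 \<eta> \<gamma> \<kappa> C \<omega> t"
        by (rule disk_state_cong[OF _ that]) (use elim in \<open>auto simp: gf'_def\<close>)
      then show ?case by (simp add: disk_x_def)
    qed
  qed (use norm_gF_disk_x_sq_measurable[OF that] in auto)
  then have "A * (\<Sum>t\<in>{0..T}. ?I gf t) \<le> A * (\<Sum>t\<in>{0..T}. ?I gf' t)"
    using A_pos by (intro mult_left_mono sum_mono) auto
  also have "\<dots> \<le> F x0 - Inf (range F) + \<beta> * (norm (gF x0))\<^sup>2 + real T * noise"
    using A_pos by (intro sum_expectation_norm_gF_sq_le) auto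
  finally have "(\<Sum>t\<in>{0..T}. ?I gf t) \<le> (F x0 - Inf (range F) + \<beta> * (norm (gF x0))\<^sup>2 + real T * noise) / A"
    using A_pos by (simp add: pos_le_divide_eq mult.commute)
  then have "(1 / real T) * (\<Sum>t\<in>{0..T}. ?I gf t)
      \<le> (1 / real T) * ((F x0 - Inf (range F) + \<beta> * (norm (gF x0))\<^sup>2 + real T * noise) / A)"
    by (intro mult_left_mono) auto
  also have "\<dots> = 2 * (F x0 + \<beta> * (norm (gF x0))\<^sup>2 - Inf (range F)) / (M1 * \<eta> * real T) + 2 * noise / (M1 * \<eta>)"
  proof -
    have "(1 / real T) * ((X + real T * noise) / A) = 2 * X / (M1 * \<eta> * real T) + 2 * noise / (M1 * \<eta>)" for X
      using T_pos M1 eta_pos unfolding A_eq by (simp add: field_simps)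
    moreover have "F x0 - Inf (range F) + \<beta> * (norm (gF x0))\<^sup>2 = F x0 + \<beta> * (norm (gF x0))\<^sup>2 - Inf (range F)" by simp
    ultimately show ?thesis by (simp only:)
  qed
  also have "2 * noise / (M1 * \<eta>) = 2 * (\<beta> + \<eta>\<^sup>2 * L) * \<kappa>\<^sup>2 / (M1 * \<eta>)
             * ((2 + \<bar>1 + \<gamma>\<bar>) * \<sigma>SGD\<^sup>2 / real B + real CARD('d) * \<sigma>DP\<^sup>2)"
    by (simp add: noise_def)
  finally show ?thesis unfolding Let_def M1_def R_def M\<gamma>_def .
qed

end
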